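(* Let $\mathbb{F}$ be an arbitrary field, $G$ a torsion-free group, and let $\alpha,\beta$ be non-zero elements of the group algebra $\mathbb{F}[G]$. If $|supp(\alpha)|=3$ and $\alpha\beta=0$, then $|supp(\beta)|\geq 10$.
   Context: For $\alpha=\sum_{x\in G}a_xx\in\mathbb{F}[G]$, $supp(\alpha)=\{x\in G: a_x\neq 0\}$. *)

theory Defs
  imports "HOL-Library.Poly_Mapping"
begin

(* The group algebra F[G] is the library type of finitely supported functions from G to F
   with its convolution product; Poly_Mapping.keys is the support.  Poly_Mapping writes the monoid of
   exponents additively, so G is a type of class group_add.  That class does not assume
   commutativity: G is an arbitrary group, with 0 its identity and + its operation. *)

(* ((+) g ^^ n) 0 is the n-th power of g, i.e. g + (g + ... + (g + 0)) with n summands. *)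
definition torsion_free :: "'g::group_add itself \<Rightarrow> bool" where
  "torsion_free _ \<longleftrightarrow> (\<forall>g::'g. \<forall>n::nat. n > 0 \<and> ((+) g ^^ n) 0 = 0 \<longrightarrow> g = 0)"

end

theory Submission
  imports Defs
begin

text \<open>
  If \<open>\<alpha> * \<beta> = 0\<close> then every product of an element of the support \<open>S = {s\<^sub>0, s\<^sub>1, s\<^sub>2}\<close> of \<open>\<alpha>\<close> with
  an element of the support \<open>B\<close> of \<open>\<beta>\<close> has a second representation as such a product. Draw an edge
  between \<open>b\<close> and \<open>c\<close> in \<open>B\<close> for every coincidence \<open>s\<^sub>i + b = s\<^sub>j + c\<close>. Closed walks in this graph are
  relations between \<open>x = - s\<^sub>0 + s\<^sub>1\<close> and \<open>y = - s\<^sub>0 + s\<^sub>2\<close>. The subgroup generated by \<open>x\<close> and \<open>y\<close> is not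
  left-orderable, since otherwise some product would be unique. This excludes abelian groups and groups
  with a relation \<open>p + q - p = n q\<close> between two generators, and hence all nontrivial closed walks of length
  at most 4 except those that present, up to a permutation of \<open>S\<close>, the trefoil group by one of two words
  \<open>D\<close> and \<open>H\<close>. Any two different relations of these kinds force \<open>x\<close> and \<open>y\<close> to commute, so only one
  of them can hold. A graph with at most 9 vertices in which all short closed walks come from a single
  relation does not exist; as each vertex needs a partner for each \<open>i\<close>, this is a small finite search.
\<close>

section \<open>Integer multiples in a non-commutative group\<close>

text \<open>Natural multiples keep the form used in \<open>torsion_free\<close>, so that
  \<open>zmul_eq_0_iff\<close> can appeal to it; negative ones are needed for relations such as
  \<open>p + q = - q + p\<close>.\<close>

definition zmul :: "int \<Rightarrow> 'g::group_add \<Rightarrow> 'g" where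
  "zmul k g = (if 0 \<le> k then ((+) g ^^ nat k) 0 else - ((+) g ^^ nat (- k)) 0)"

lemma zmul_0 [simp]: "zmul 0 g = 0"
  by (simp add: zmul_def)

lemma funpow_add_commute: "g + ((+) g ^^ n) 0 = ((+) g ^^ n) 0 + g" for g :: "'g::group_add"
  by (induction n) (simp_all, metis add.assoc)

lemma zmul_succ: "zmul (k + 1) g = zmul k g + g"
proof -
  consider "0 \<le> k" | "k = - 1" | "k < - 1" by linarith
  then show ?thesis
  proof cases
    case 1
    then show ?thesis by (simp add: zmul_def nat_add_distrib funpow_add_commute)
  next
    case 2
    then show ?thesis by (simp add: zmul_def)
  next
    case 3
    then have "nat (- k) = Suc (nat (- (k + 1)))" by linarith
    with 3 show ?thesis by (simp add: zmul_def minus_add)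
  qed
qed

lemma zmul_pred: "zmul (k - 1) g = zmul k g - g"
  using zmul_succ[of "k - 1" g] by simp

lemma zmul_1 [simp]: "zmul 1 g = g"
  using zmul_succ[of 0 g] by simp

lemma zmul_minus_1 [simp]: "zmul (- 1) g = - g"
  using zmul_pred[of 0 g] by simp

lemma zmul_2: "zmul 2 g = g + g"
  using zmul_succ[of 1 g] by simp

lemma zmul_add: "zmul (k + l) g = zmul k g + zmul l g"
proof (induction l rule: int_induct[where k = 0])
  case (step1 i)
  then show ?case by (metis add.assoc zmul_succ)
next
  case (step2 i)
  then show ?case by (metis add_diff_eq zmul_pred)
qed simp

lemma zmul_minus: "zmul (- k) g = - zmul k g"
  using zmul_add[of "- k" k g] by (simp add: eq_neg_iff_add_eq_0)

lemma zmul_mult: "zmul (k * l) g = zmul k (zmul l g)"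
  by (induction k rule: int_induct[where k = 0])
    (simp_all add: zmul_succ zmul_pred ring_distribs zmul_add zmul_minus flip: add_uminus_conv_diff)

lemma zmul_zero [simp]: "zmul k 0 = 0"
  using zmul_mult[of k 0 0] by simp

text \<open>Conjugation by \<open>p\<close> is an endomorphism that sends \<open>q\<close> to
  \<open>zmul n q\<close>, so it multiplies exponents of \<open>q\<close> by
  \<open>n\<close>.\<close>

lemma zmul_conj:
  assumes "p + q = zmul n q + p"
  shows "p + zmul m q = zmul (m * n) q + p"
proof (induction m rule: int_induct[where k = 0])
  case (step1 m)
  have "p + zmul (m + 1) q = zmul (m * n) q + (p + q)"
    by (simp add: zmul_succ step1.IH flip: add.assoc)
  then show ?case
    by (simp add: assms ring_distribs zmul_add add.assoc)
next
  case (step2 m)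
  have "p - q = zmul (- n) q + p"
    using assms by (simp add: zmul_minus diff_eq_eq add.assoc minus_add_cancel)
  moreover have "p + zmul (m - 1) q = zmul (m * n) q + (p - q)"
    using step2.IH by (simp add: zmul_pred add_diff_eq)
  ultimately have "p + zmul (m - 1) q = zmul (m * n + - n) q + p"
    by (simp only: zmul_add add.assoc)
  then show ?case
    by (simp add: left_diff_distrib)
qed simp

text \<open>The exponent of \<open>p\<close> is natural because conjugation by \<open>- p\<close>
  would have to divide exponents of \<open>q\<close> by \<open>n\<close>.\<close>

lemma zmul_conj_power:
  assumes "p + q = zmul n q + p"
  shows "zmul (int k) p + zmul m q = zmul (m * n ^ k) q + zmul (int k) p"
proof (induction k arbitrary: m)
  case (Suc k)
  have "zmul (int (Suc k)) p + zmul m q = zmul (int k) p + (p + zmul m q)"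
    using zmul_succ[of "int k" p] by (simp add: add.commute[of 1] add.assoc)
  also have "\<dots> = zmul (m * n ^ Suc k) q + (zmul (int k) p + p)"
    by (simp add: zmul_conj[OF assms] Suc.IH ac_simps flip: add.assoc)
  finally show ?case
    using zmul_succ[of "int k" p] by (simp add: add.commute[of 1])
qed simp

lemma zmul_commute:
  assumes "p + q = q + p"
  shows "zmul k p + zmul m q = zmul m q + zmul k p"
proof -
  have 1: "g + zmul m h = zmul m h + g" if "g + h = h + g" for g h :: 'a and m
    using zmul_conj[of g h 1 m] that by simp
  show ?thesis
    using 1[OF 1[OF assms[symmetric], symmetric]] .
qed

lemma zmul_distrib:
  assumes "p + q = q + p"
  shows "zmul k (p + q) = zmul k p + zmul k q"
proof -
  have comm: "zmul l q + p = p + zmul l q" "zmul l q + - p = - p + zmul l q" for l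
    using zmul_commute[OF assms, of 1 l] zmul_commute[OF assms, of "- 1" l] by simp_all
  show ?thesis
  proof (induction k rule: int_induct[where k = 0])
    case (step1 k)
    have "zmul (k + 1) (p + q) = zmul k p + (zmul k q + p) + q"
      by (simp add: zmul_succ step1.IH add.assoc)
    then show ?case
      by (simp add: comm zmul_succ add.assoc)
  next
    case (step2 k)
    have "zmul (k - 1) (p + q) = zmul k p + (zmul k q + - p) + - q"
      unfolding zmul_pred step2.IH by (simp only: assms diff_conv_add_uminus minus_add add.assoc)
    also have "\<dots> = (zmul k p - p) + (zmul k q - q)"
      by (simp only: comm diff_conv_add_uminus add.assoc)
    finally show ?case
      by (simp only: zmul_pred)
  qed simp
qed

lemma zmul_eq_0_iff:
  fixes g :: "'g::group_add"
  assumes "torsion_free TYPE('g)"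
  shows "zmul k g = 0 \<longleftrightarrow> k = 0 \<or> g = 0"
proof -
  have "((+) 0 ^^ n) 0 = (0 :: 'g)" for n
    by (induction n) auto
  moreover have "g = 0" if "((+) g ^^ n) 0 = 0" "n > 0" for n
    using assms that unfolding torsion_free_def by blast
  ultimately show ?thesis
    by (cases "k = 0") (auto simp: zmul_def split: if_splits)
qed

section \<open>Sets without unique products\<close>

datatype colour = C0 | C1 | C2

lemma UNIV_colour: "UNIV = {C0, C1, C2}"
  by (auto intro: colour.exhaust)

instance colour :: finite
  by standard (simp add: UNIV_colour)

text \<open>This is all that is kept of a zero divisor: the coefficients are gone. Indexing the
  three elements by colours lets permutations of them act by composition with
  \<open>s\<close>.\<close>

locale no_unique_product =
  fixes s :: "colour \<Rightarrow> 'g::group_add" and B :: "'g set"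
  assumes torsion_free: "torsion_free TYPE('g)"
    and inj_s: "inj s"
    and finite_B: "finite B"
    and B_nonempty: "B \<noteq> {}"
    and no_unique: "b \<in> B \<Longrightarrow> \<exists>j c. j \<noteq> i \<and> c \<in> B \<and> s i + b = s j + c"
begin

text \<open>\<open>P\<close> is the positive cone of a left-invariant total order on
  \<open>H\<close>. The largest product formed with the part of \<open>B\<close> in one coset of
  \<open>H\<close> has two representations. Their second factors differ, and exchanging the smaller
  of them for the larger gives a still larger product.\<close>

lemma not_left_orderable:
  assumes H_add: "\<And>u v. u \<in> H \<Longrightarrow> v \<in> H \<Longrightarrow> u + v \<in> H"
    and H_minus: "\<And>u. u \<in> H \<Longrightarrow> - u \<in> H"
    and H_s: "\<And>i. - s C0 + s i \<in> H"
    and P_add: "\<And>u v. u \<in> P \<Longrightarrow> v \<in> P \<Longrightarrow> u + v \<in> P"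
    and P_0: "0 \<notin> P"
    and P_total: "\<And>u. u \<in> H \<Longrightarrow> u = 0 \<or> u \<in> P \<or> - u \<in> P"
  shows False
proof -
  obtain b0 where b0: "b0 \<in> B"
    using B_nonempty by auto
  \<comment> \<open>One coset, translated into \<open>H\<close>, is enough: the second
    representation of a product stays in the same coset, as \<open>c'\<close> lies in
    \<open>H\<close> below.\<close>
  define C where "C = {b - b0 | b. b \<in> B \<and> b - b0 \<in> H}"
  define A where "A = (\<lambda>(i, c). - s C0 + s i + c) ` (UNIV \<times> C)"
  define less where "less u v \<longleftrightarrow> - u + v \<in> P" for u v
  have H_0: "0 \<in> H"
    using H_s[of C0] by simp
  have fin: "finite C"
    using finite_B unfolding C_def by (rule finite_subset[rotated, OF finite_imageI]) auto
  have "0 \<in> C"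
    using b0 H_0 by (force simp: C_def)
  have less_trans: "less u w" if "less u v" "less v w" for u v w
    using P_add[of "- u + v" "- v + w"] that by (simp add: less_def add.assoc)
  have less_irrefl: "\<not> less u u" for u
    using P_0 by (simp add: less_def)
  have "\<exists>m\<in>A. \<forall>x\<in>A. x \<noteq> m \<longrightarrow> \<not> less m x"
  proof (rule Finite_Set.bex_max_element)
    show "asymp_on A less"
      using less_trans less_irrefl by (blast intro: asymp_onI)
    show "transp_on A less"
      using less_trans by (blast intro: transp_onI)
    show "finite A" "A \<noteq> {}"
      using fin \<open>0 \<in> C\<close> by (auto simp: A_def)
  qed
  then obtain m where m: "m \<in> A" "\<And>x. x \<in> A \<Longrightarrow> \<not> less m x"
    using less_irrefl by metis
  from m(1) obtain i c where c: "c \<in> C" "m = - s C0 + s i + c"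
    by (auto simp: A_def)
  then obtain b where b: "b \<in> B" "c = b - b0" "c \<in> H"
    by (auto simp: C_def)
  obtain j b' where j: "j \<noteq> i" "b' \<in> B" "s i + b = s j + b'"
    using no_unique[OF b(1)] by blast
  define c' where "c' = b' - b0"
  have m': "m = - s C0 + s j + c'"
    using j(3) unfolding c(2) b(2) c'_def by (simp add: add.assoc add_diff_eq)
  have "c' = - (- s C0 + s j) + ((- s C0 + s i) + c)"
    using m' c(2) by (metis minus_add_cancel)
  then have "c' \<in> H"
    using H_add H_minus H_s b(3) by metis
  then have "c' \<in> C"
    using j(2) by (auto simp: C_def c'_def)
  have "c \<noteq> c'"
    using m' c(2) j(1) inj_s by (auto simp: inj_def)
  then have "- c + c' \<noteq> 0"
    by (simp add: neg_eq_iff_add_eq_0[symmetric])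
  moreover have "- c + c' \<in> H"
    using H_add H_minus b(3) \<open>c' \<in> H\<close> by blast
  moreover have "- (- c + c') = - c' + c"
    by (simp add: minus_add)
  ultimately have "less c c' \<or> less c' c"
    using P_total by (metis less_def)
  moreover have "less (g + u) (g + v) \<longleftrightarrow> less u v" for g u v
    unfolding less_def by (metis minus_add add.assoc minus_add_cancel)
  ultimately have "less m (- s C0 + s i + c') \<or> less m (- s C0 + s j + c)"
    using c(2) m' by metis
  moreover have "- s C0 + s i + c' \<in> A" "- s C0 + s j + c \<in> A"
    using \<open>c' \<in> C\<close> c(1) by (auto simp: A_def)
  ultimately show False
    using m(2) by blast
qed

section \<open>Left orders on abelian and Baumslag-Solitar groups\<close>

definition x where "x = - s C0 + s C1"
definition y where "y = - s C0 + s C2"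

lemma x_nonzero: "x \<noteq> 0" and y_nonzero: "y \<noteq> 0"
  using inj_s by (auto simp: x_def y_def inj_eq neg_eq_iff_add_eq_0[symmetric])

lemma H_s:
  assumes "0 \<in> H" "x \<in> H" "y \<in> H"
  shows "- s C0 + s i \<in> H"
  using assms by (cases i) (auto simp: x_def y_def)

text \<open>Normal form \<open>p\<^bsup>-a\<^esup> q\<^sup>m p\<^sup>b\<close> (with natural \<open>a\<close>, \<open>b\<close>) of the elements of a group generated by \<open>p\<close>
  and \<open>q\<close> with \<open>p q p\<^bsup>-1\<^esup> = q\<^sup>n\<close>.\<close>

definition bs_form where
  "bs_form p q a m b = - zmul (int a) p + zmul m q + zmul (int b) p"

text \<open>The form is not unique: inserting \<open>zmul (- k) p\<close> and
  \<open>zmul k p\<close> around \<open>zmul m q\<close> replaces \<open>m\<close> by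
  \<open>m * n ^ k\<close>. This acts as expanding a fraction.\<close>

lemma bs_form_shift:
  assumes "p + q = zmul n q + p"
  shows "bs_form p q a m b = bs_form p q (a + k) (m * n ^ k) (b + k)"
proof -
  have "zmul (int (a + k)) p = zmul (int k) p + zmul (int a) p" "zmul (int (b + k)) p = zmul (int k) p + zmul (int b) p"
    by (simp_all flip: zmul_add add: add.commute)
  then have "bs_form p q (a + k) (m * n ^ k) (b + k)
      = - zmul (int a) p + - zmul (int k) p + (zmul (m * n ^ k) q + zmul (int k) p) + zmul (int b) p"
    by (simp add: bs_form_def minus_add add.assoc flip: add_uminus_conv_diff)
  also have "\<dots> = bs_form p q a m b"
    unfolding zmul_conj_power[OF assms, symmetric]
    by (simp add: bs_form_def add.assoc flip: add_uminus_conv_diff)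
  finally show ?thesis ..
qed

text \<open>Both forms are shifted so that the inner exponents of \<open>p\<close> become
  \<open>b + c\<close> and cancel.\<close>

lemma bs_form_add:
  assumes "p + q = zmul n q + p"
  shows "bs_form p q a m b + bs_form p q c k d = bs_form p q (a + c) (m * n ^ c + k * n ^ b) (b + d)"
proof -
  have "bs_form p q a m b + bs_form p q c k d
      = bs_form p q (a + c) (m * n ^ c) (b + c) + bs_form p q (b + c) (k * n ^ b) (b + d)"
    using bs_form_shift[OF assms, of a m b c] bs_form_shift[OF assms, of c k d b] by (simp add: add.commute)
  then show ?thesis
    by (simp add: bs_form_def zmul_add add.assoc)
qed

lemma bs_form_minus: "- bs_form p q a m b = bs_form p q b (- m) a"
  by (simp add: bs_form_def minus_add zmul_minus add.assoc flip: add_uminus_conv_diff)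

definition bs_forms where "bs_forms p q = {bs_form p q a m b | a m b. True}"

lemma bs_forms_generators: "0 \<in> bs_forms p q" "p \<in> bs_forms p q" "q \<in> bs_forms p q"
proof -
  have "bs_form p q 0 0 0 = 0" "bs_form p q 0 0 1 = p" "bs_form p q 0 1 0 = q"
    by (simp_all add: bs_form_def)
  then show "0 \<in> bs_forms p q" "p \<in> bs_forms p q" "q \<in> bs_forms p q"
    unfolding bs_forms_def by (metis (mono_tags, lifting) mem_Collect_eq)+
qed

lemma bs_forms_closed:
  assumes "p + q = zmul n q + p"
  shows "u \<in> bs_forms p q \<Longrightarrow> v \<in> bs_forms p q \<Longrightarrow> u + v \<in> bs_forms p q"
    and "u \<in> bs_forms p q \<Longrightarrow> - u \<in> bs_forms p q"
  unfolding bs_forms_def using bs_form_add[OF assms] bs_form_minus by blast+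

text \<open>The cone is the set of elements with at least one positive triple. Hence
  \<open>pos\<close> need not be compared on different triples of the same element.\<close>

lemma cone_contradiction:
  assumes rel: "p + q = zmul n q + p"
    and xy: "x \<in> bs_forms p q" "y \<in> bs_forms p q"
    and add: "\<And>a m b c k d. pos a m b \<Longrightarrow> pos c k d \<Longrightarrow> pos (a + c) (m * n ^ c + k * n ^ b) (b + d)"
    and nonzero: "\<And>a m b. pos a m b \<Longrightarrow> bs_form p q a m b \<noteq> 0"
    and total: "\<And>a m b. pos a m b \<or> pos b (- m) a \<or> bs_form p q a m b = 0"
  shows False
proof (rule not_left_orderable)
  let ?P = "{bs_form p q a m b | a m b. pos a m b}"
  show "u + v \<in> bs_forms p q" if "u \<in> bs_forms p q" "v \<in> bs_forms p q" for u v
    using bs_forms_closed(1)[OF rel] that .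
  show "- u \<in> bs_forms p q" if "u \<in> bs_forms p q" for u
    using bs_forms_closed(2)[OF rel] that .
  show "- s C0 + s i \<in> bs_forms p q" for i
    using xy bs_forms_generators by (intro H_s)
  show "u + v \<in> ?P" if "u \<in> ?P" "v \<in> ?P" for u v
    using that add bs_form_add[OF rel] by blast
  show "0 \<notin> ?P"
    using nonzero by fastforce
  show "u = 0 \<or> u \<in> ?P \<or> - u \<in> ?P" if "u \<in> bs_forms p q" for u
    using that total bs_form_minus unfolding bs_forms_def by blast
qed

lemmas zmul_eq_0 = zmul_eq_0_iff[OF torsion_free]

text \<open>A torsion-free abelian group on two generators is orderable; the proof exhibits the
  cone, using the normal form with \<open>n = 1\<close>.\<close>

lemma not_commute: "x + y \<noteq> y + x"
proof
  assume comm: "x + y = y + x"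
  have rel: "x + y = zmul 1 y + x"
    using comm by simp
  have gens: "x \<in> bs_forms x y" "y \<in> bs_forms x y"
    using bs_forms_generators by blast+
  have form: "bs_form x y a m b = zmul (int b - int a) x + zmul m y" for a m b
    using zmul_commute[OF comm, of "int b" m] zmul_add[of "- int a" "int b" x]
    by (simp add: bs_form_def add.assoc flip: zmul_minus)
  show False
  \<comment> \<open>In rank one, \<open>x\<close> goes to \<open>l\<close> and \<open>y\<close> to
    \<open>k\<close> under a map to the integers, whose sign gives the order. In rank two the
    exponents of \<open>x\<close> and \<open>y\<close> are ordered lexicographically.\<close>
  proof (cases "\<exists>k l. k > 0 \<and> zmul k x = zmul l y")
    case True
    then obtain k l where kl: "k > 0" "zmul k x = zmul l y"
      by blast
    have key: "zmul k (bs_form x y a m b) = zmul ((int b - int a) * l + m * k) y" for a m b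
    proof -
      have "zmul k (bs_form x y a m b) = zmul k (zmul (int b - int a) x) + zmul k (zmul m y)"
        unfolding form using zmul_commute[OF comm] by (intro zmul_distrib)
      also have "\<dots> = zmul (int b - int a) (zmul k x) + zmul (m * k) y"
        by (simp flip: zmul_mult add: mult.commute)
      finally show ?thesis
        by (simp add: kl(2) zmul_add zmul_mult)
    qed
    show False
    proof (rule cone_contradiction[OF rel gens, where pos = "\<lambda>a m b. (int b - int a) * l + m * k > 0"])
      show "(int (b + d) - int (a + c)) * l + (m * 1 ^ c + h * 1 ^ b) * k > 0"
        if "(int b - int a) * l + m * k > 0" "(int d - int c) * l + h * k > 0" for a m b c h d
        using that by (simp add: algebra_simps)
      show "bs_form x y a m b \<noteq> 0" if "(int b - int a) * l + m * k > 0" for a m b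
        using key[of a m b] that y_nonzero by (auto simp: zmul_eq_0)
      show "(int b - int a) * l + m * k > 0 \<or> (int a - int b) * l + - m * k > 0 \<or> bs_form x y a m b = 0" for a m b
        using key[of a m b] kl(1) by (cases "(int b - int a) * l + m * k = 0") (auto simp: zmul_eq_0 algebra_simps)
    qed
  next
    case False
    show False
    proof (rule cone_contradiction[OF rel gens, where pos = "\<lambda>a m b. a < b \<or> a = b \<and> 0 < m"])
      show "bs_form x y a m b \<noteq> 0" if "a < b \<or> a = b \<and> 0 < m" for a m b
      proof
        assume "bs_form x y a m b = 0"
        then have "zmul (int b - int a) x = zmul (- m) y"
          by (simp add: form zmul_minus eq_neg_iff_add_eq_0)
        with False have "\<not> int b - int a > 0"
          by blast
        with that \<open>bs_form x y a m b = 0\<close> show False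
          using y_nonzero by (auto simp: form zmul_eq_0)
      qed
      show "(a < b \<or> a = b \<and> 0 < m) \<or> (b < a \<or> b = a \<and> 0 < - m) \<or> bs_form x y a m b = 0" for a m b
        by (cases "m = 0"; cases "a = b") (auto simp: bs_form_def)
    qed auto
  qed
qed

text \<open>The order looks first at the total exponent \<open>b - a\<close> of \<open>p\<close>. On
  elements with \<open>a = b\<close>, the form acts like the fraction \<open>m / n ^ a\<close>,
  which has the sign of \<open>m * n ^ a\<close>. A left order requires no invariance under
  conjugation, so negative \<open>n\<close> is allowed.\<close>

lemma not_baumslag_solitar:
  assumes rel: "p + q = zmul n q + p"
    and xy: "x \<in> bs_forms p q" "y \<in> bs_forms p q"
  shows False
proof (cases "p + q = q + p")
  case True
  have "u + v = v + u" if "u \<in> bs_forms p q" "v \<in> bs_forms p q" for u v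
  proof -
    have rel': "p + q = zmul 1 q + p"
      using True by simp
    show ?thesis
      using that by (auto simp: bs_forms_def bs_form_add[OF rel'] add.commute)
  qed
  then show False
    using xy not_commute by blast
next
  case False
  have p: "p \<noteq> 0" and q: "q \<noteq> 0" and n1: "n \<noteq> 1"
    using False rel by auto
  have n0: "n \<noteq> 0"
    using rel q add_left_cancel[of p q 0] by auto
  show False
  proof (rule cone_contradiction[OF rel xy, where pos = "\<lambda>a m b. a < b \<or> a = b \<and> 0 < m * n ^ a"])
    show "a + c < b + d \<or> a + c = b + d \<and> 0 < (m * n ^ c + k * n ^ b) * n ^ (a + c)"
      if "a < b \<or> a = b \<and> 0 < m * n ^ a" "c < d \<or> c = d \<and> 0 < k * n ^ c" for a m b c k d
    proof (cases "a = b \<and> c = d")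
      case True
      have "(m * n ^ c + k * n ^ b) * n ^ (a + c) = (m * n ^ a) * (n ^ c)\<^sup>2 + (k * n ^ c) * (n ^ a)\<^sup>2"
        using True by (simp add: algebra_simps power_add power2_eq_square)
      moreover have "(m * n ^ a) * (n ^ c)\<^sup>2 > 0" "(k * n ^ c) * (n ^ a)\<^sup>2 > 0"
        using True that n0 by auto
      ultimately show ?thesis
        using True by simp
    qed (use that in auto)
    show "bs_form p q a m b \<noteq> 0" if "a < b \<or> a = b \<and> 0 < m * n ^ a" for a m b
    proof
      assume 0: "bs_form p q a m b = 0"
      have "- zmul (int a) p + zmul m q = - zmul (int b) p"
        using 0 by (simp add: bs_form_def eq_neg_iff_add_eq_0)
      then have "zmul m q = zmul (int a) p + - zmul (int b) p"
        by (metis add_minus_cancel)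
      \<comment> \<open>As a multiple of \<open>p\<close>, the element \<open>zmul m q\<close>
        commutes with \<open>p\<close>; but conjugation by \<open>p\<close> multiplies its exponent
        by \<open>n\<close>, which is not 1, so \<open>m\<close> must vanish.\<close>
      then have mq: "zmul m q = zmul (int a - int b) p"
        using zmul_add[of "int a" "- int b" p] by (simp add: zmul_minus)
      then have "p + zmul m q = zmul m q + p"
        using zmul_add[of 1 "int a - int b" p] zmul_add[of "int a - int b" 1 p] by (simp add: add.commute)
      then have "zmul (m * n) q = zmul m q"
        using zmul_conj[OF rel, of m] by simp
      then have "zmul (m * n - m) q = 0"
        using zmul_add[of "m * n" "- m" q] by (simp add: zmul_minus)
      then have "m = 0"
        using q n1 by (auto simp: zmul_eq_0)
      with that have "a < b" by simp
      with mq \<open>m = 0\<close> p show False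
        by (simp add: zmul_eq_0)
    qed
    show "(a < b \<or> a = b \<and> 0 < m * n ^ a) \<or> (b < a \<or> b = a \<and> 0 < - m * n ^ b) \<or> bs_form p q a m b = 0" for a m b
    proof (cases "a = b \<and> m = 0")
      case False
      moreover have "m = 0 \<or> m * n ^ a < 0 \<or> 0 < m * n ^ a"
        using n0 by (metis linorder_neqE_linordered_idom mult_eq_0_iff power_not_zero)
      ultimately show ?thesis by auto
    qed (simp add: bs_form_def)
  qed
qed

end

section \<open>Closed walks and the relations they give\<close>

text \<open>A walk that passes from \<open>b\<close> to \<open>c\<close> through a coincidence \<open>s i + b = s j + c\<close> is recorded by the colours
  \<open>i\<close>, \<open>j\<close>; later steps stand further left, so that the walk \<open>j # i # w\<close> displaces by \<open>- s j + s i + disp s w\<close>.\<close>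

fun disp :: "('c \<Rightarrow> 'g::group_add) \<Rightarrow> 'c list \<Rightarrow> 'g" where
  "disp s (a # b # w) = - s a + s b + disp s w"
| "disp s w = 0"

lemma disp_append: "even (length u) \<Longrightarrow> disp s (u @ w) = disp s u + disp s w"
  by (induction u rule: induct_list012) (auto simp: add.assoc)

lemma disp_rev: "even (length w) \<Longrightarrow> disp s (rev w) = - disp s w"
proof (induction w rule: induct_list012)
  case (3 a b w)
  then have "disp s (rev (a # b # w)) = - disp s w + (- s b + s a)"
    by (simp add: disp_append)
  then show ?case
    by (simp add: minus_add add.assoc flip: add_uminus_conv_diff)
qed simp_all

lemma disp_map: "disp s (map p w) = disp (s \<circ> p) w"
  by (induction w rule: induct_list012) auto

lemma disp_translate: "disp (\<lambda>i. g + s i) w = disp s w"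
proof (induction w rule: induct_list012)
  case (3 a b w)
  have "- (g + s a) + (g + s b) = - s a + s b"
    by (metis minus_add add.assoc minus_add_cancel)
  with 3 show ?case by simp
qed simp_all

text \<open>One step of a walk takes two letters. The signs in \<open>disp\<close> alternate, so it
  is a shift by two letters that conjugates the displacement.\<close>

fun rotate2 :: "'a list \<Rightarrow> 'a list" where
  "rotate2 (a # b # w) = w @ [a, b]"
| "rotate2 w = w"

lemma length_rotate2 [simp]: "length (rotate2 w) = length w"
  by (cases w rule: rotate2.cases) auto

lemma disp_rotate2:
  fixes s :: "'c \<Rightarrow> 'g::group_add"
  assumes "even (length w)"
  shows "disp s (rotate2 w) = 0 \<longleftrightarrow> disp s w = 0"
proof (cases w rule: rotate2.cases)
  case (1 a b v)
  have "u + v = 0 \<longleftrightarrow> v + u = 0" for u v :: 'g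
    by (metis eq_neg_iff_add_eq_0 neg_eq_iff_add_eq_0)
  then show ?thesis
    using 1 assms by (auto simp: disp_append)
qed auto

text \<open>The words read off the same closed walk from other starting points or in the opposite direction.\<close>

definition variants :: "'a list \<Rightarrow> 'a list list" where
  "variants w = concat (map (\<lambda>v. [v, rev v]) [w, rotate2 w, rotate2 (rotate2 w), rotate2 (rotate2 (rotate2 w))])"

lemma disp_variants:
  assumes "v \<in> set (variants w)" "even (length w)"
  shows "disp s v = 0 \<longleftrightarrow> disp s w = 0"
  using assms by (auto simp: variants_def disp_rev disp_rotate2)

text \<open>For the colours in their order this gives \<open>x + x + y - x + y = 0\<close>. With
  \<open>t = - x + y\<close> it reads \<open>x + x + x + t + t = 0\<close>, a presentation of the
  trefoil group.\<close>

definition word_D where "word_D a b c = [a, b, a, b, a, c, b, c]"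
text \<open>This gives \<open>x + y - x - x + y = 0\<close>, which in \<open>x\<close> and
  \<open>t = - x + y\<close> is \<open>x + x + t - x + t = 0\<close>, the relation of
  \<open>word_D\<close> with \<open>t\<close> for \<open>y\<close>.\<close>

definition word_H where "word_H a b c = [a, b, a, c, b, a, b, c]"

text \<open>Representatives, up to \<open>variants\<close> and permutations of the colours, of the words of length at most 8 other
  than \<open>word_D\<close> and \<open>word_H\<close>. Each of them gives torsion, commutativity or a Baumslag--Solitar relation.\<close>

definition solvable_words where
  "solvable_words a b c =
    [[a, b], [a, b, a, b], [a, b, a, c],
     [a, b, a, b, a, b], [a, b, a, b, a, c], [a, b, a, c, b, c], [a, b, c, a, b, c],
     [a, b, a, b, a, b, a, b], [a, b, a, b, a, b, a, c], [a, b, a, b, a, c, a, c], [a, b, a, b, c, a, b, c],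
     [a, b, a, b, c, b, a, c], [a, b, a, c, a, b, a, c], [a, b, a, c, a, b, c, b], [a, b, a, c, b, a, c, b]]"

section \<open>Enumeration of the cyclic words of length at most 8\<close>

definition orders :: "(colour \<times> colour \<times> colour) list" where
  "orders = [(C0, C1, C2), (C0, C2, C1), (C1, C0, C2), (C1, C2, C0), (C2, C0, C1), (C2, C1, C0)]"

fun others :: "colour \<Rightarrow> colour list" where
  "others C0 = [C1, C2]" | "others C1 = [C0, C2]" | "others C2 = [C0, C1]"

lemma set_others: "set (others i) = UNIV - {i}"
  by (cases i) (auto simp: UNIV_colour)

fun words :: "nat \<Rightarrow> colour \<Rightarrow> colour list list" where
  "words 0 i = [[]]"
| "words (Suc n) i = concat (map (\<lambda>j. map ((#) j) (words n j)) (others i))"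

lemma words: "distinct_adj (i # w) \<Longrightarrow> w \<in> set (words (length w) i)"
  by (induction w arbitrary: i) (auto simp: set_others)

text \<open>Equal neighbours would lengthen a word without adding a relation; excluding them, also
  across the ends, leaves the cyclically reduced words.\<close>

definition cyclic_word :: "'a list \<Rightarrow> bool" where
  "cyclic_word w \<longleftrightarrow> w \<noteq> [] \<and> even (length w) \<and> distinct_adj (w @ [hd w])"

text \<open>Interchanging the first two arguments of \<open>word_H\<close> amounts to applying
  \<open>rotate2\<close> twice, so three arrangements stand for all six.\<close>

definition all_words :: "colour list list" where
  "all_words = concat (map (\<lambda>(a, b, c). solvable_words a b c @ [word_D a b c]) orders) @ 
     [word_H C0 C1 C2, word_H C0 C2 C1, word_H C1 C2 C0]"

fun same :: "'a list \<Rightarrow> 'a list \<Rightarrow> bool" where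
  "same [] [] = True"
| "same (a # v) (b # w) = (if a = b then same v w else False)"
| "same v w = False"

lemma same_iff: "same v w \<longleftrightarrow> v = w"
  by (induction v w rule: same.induct) auto

fun delete :: "'a list \<Rightarrow> 'a list list \<Rightarrow> 'a list list" where
  "delete v [] = []"
| "delete v (w # ws) = (if same v w then ws else w # delete v ws)"

fun delete_all :: "'a list list \<Rightarrow> 'a list list \<Rightarrow> 'a list list" where
  "delete_all [] ws = ws"
| "delete_all (v # vs) ws = delete_all vs (delete v ws)"

text \<open>The filter saves comparisons: the lists to be sifted contain only words that begin with
  \<open>i\<close>.\<close>

fun sift :: "'a \<Rightarrow> 'a list list \<Rightarrow> 'a list list \<Rightarrow> 'a list list" where
  "sift i [] ws = ws"
| "sift i (v # vs) ws = sift i vs (delete_all (filter (\<lambda>u. hd u = i) (variants v)) ws)"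

lemma set_delete: "set ws \<subseteq> insert v (set (delete v ws))"
  by (induction v ws rule: delete.induct) (auto simp: same_iff)

lemma set_delete_all: "set ws \<subseteq> set vs \<union> set (delete_all vs ws)"
proof (induction vs ws rule: delete_all.induct)
  case (2 v vs ws)
  then show ?case
    using set_delete[of ws v] by auto
qed simp

lemma set_sift: "set ws \<subseteq> (\<Union>v\<in>set vs. set (variants v)) \<union> set (sift i vs ws)"
proof (induction i vs ws rule: sift.induct)
  case (2 i v vs ws)
  then show ?case
    using set_delete_all[of ws "filter (\<lambda>u. hd u = i) (variants v)"] by auto
qed simp

definition closed_words :: "colour \<Rightarrow> colour list list" where
  "closed_words i = filter (\<lambda>w. last w \<noteq> i) (map ((#) i) (words 1 i @ words 3 i @ words 5 i @ words 7 i))"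

lemma closed_words:
  assumes "cyclic_word w" "length w \<le> 8"
  shows "w \<in> set (closed_words (hd w))"
proof -
  from assms obtain i v where w: "w = i # v"
    by (auto simp: cyclic_word_def neq_Nil_conv)
  have "v \<in> set (words (length v) i)"
    using assms distinct_adj_appendD1[of "i # v" "[i]"] by (intro words) (auto simp: w cyclic_word_def)
  moreover have "odd (length v)" "length v < 8"
    using assms by (auto simp: w cyclic_word_def)
  then have "length v \<in> {1, 3, 5, 7}"
    by (simp only: insert_iff empty_iff) presburger
  moreover from \<open>odd (length v)\<close> have "v \<noteq> []"
    by auto
  then have "last v \<noteq> i"
    using assms distinct_adj_append_iff[of "i # v" "[i]"] by (auto simp: w cyclic_word_def)
  ultimately show ?thesis
    by (auto simp: w closed_words_def)
qed

text \<open>This computation shows that the list of representatives is complete: no cyclic word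
  survives the deletion of their variants.\<close>

lemma sift_closed_words:
  "sift C0 all_words (closed_words C0) = []"
  "sift C1 all_words (closed_words C1) = []"
  "sift C2 all_words (closed_words C2) = []"
  by code_simp+

lemma classification:
  assumes "cyclic_word w" "length w \<le> 8"
  shows "\<exists>v\<in>set all_words. w \<in> set (variants v)"
  using closed_words[OF assms] sift_closed_words set_sift[of "closed_words (hd w)" all_words "hd w"]
  by (cases "hd w") auto

lemma even_length_all_words: "v \<in> set all_words \<Longrightarrow> even (length v)"
  by (auto simp: all_words_def orders_def solvable_words_def word_D_def word_H_def)

fun arrange :: "colour \<Rightarrow> colour \<Rightarrow> colour \<Rightarrow> colour \<Rightarrow> colour" where
  "arrange a b c C0 = a" | "arrange a b c C1 = b" | "arrange a b c C2 = c"

lemma bij_arrange: "distinct [a, b, c] \<Longrightarrow> bij (arrange a b c)"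
proof -
  assume d: "distinct [a, b, c]"
  have "inj (arrange a b c)"
  proof (rule injI)
    fix i j assume "arrange a b c i = arrange a b c j"
    with d show "i = j" by (cases i; cases j) auto
  qed
  then show ?thesis
    by (simp add: finite_UNIV_inj_surj bij_def)
qed

section \<open>Words excluded as relators, and incompatible pairs of relators\<close>

context no_unique_product
begin

text \<open>Together with \<open>disp_map\<close> this transfers results about one arrangement of
  the colours to all six.\<close>

lemma rearranged: 
  assumes "distinct [a, b, c]"
  shows "no_unique_product (s \<circ> arrange a b c) B"
proof
  note bij = bij_arrange[OF assms]
  show "inj (s \<circ> arrange a b c)"
    using inj_s bij by (auto intro: inj_compose simp: bij_def)
  show "\<exists>j d. j \<noteq> i \<and> d \<in> B \<and> (s \<circ> arrange a b c) i + e = (s \<circ> arrange a b c) j + d" if "e \<in> B" for i e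
    using no_unique[OF that, of "arrange a b c i"] bij by (metis bij_pointE comp_apply)
qed (use torsion_free finite_B B_nonempty in auto)

text \<open>Translation by \<open>- s C0\<close> leaves \<open>disp\<close> unchanged and turns the
  three letters into \<open>0\<close>, \<open>x\<close> and \<open>y\<close>.\<close>

lemma disp_xy: "disp s w = disp (case_colour 0 x y) w"
proof -
  have "(\<lambda>i. - s C0 + s i) = case_colour 0 x y"
    by (rule ext) (simp add: x_def y_def split: colour.split)
  then show ?thesis
    using disp_translate[of "- s C0" s w] by simp
qed

lemma torsion:
  "g + g = 0 \<Longrightarrow> g = 0" "g + (g + g) = 0 \<Longrightarrow> g = 0" "g + (g + (g + g)) = 0 \<Longrightarrow> g = 0" for g :: 'g
proof -
  have "zmul 3 g = g + (g + g)" "zmul 4 g = g + (g + (g + g))"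
    using zmul_add[of 1 2 g] zmul_add[of 2 2 g] by (simp_all add: zmul_2 add.assoc)
  then show "g + g = 0 \<Longrightarrow> g = 0" "g + (g + g) = 0 \<Longrightarrow> g = 0" "g + (g + (g + g)) = 0 \<Longrightarrow> g = 0"
    using zmul_eq_0[of 2 g] zmul_eq_0[of 3 g] zmul_eq_0[of 4 g] by (simp_all add: zmul_2)
qed

lemma zmul_minus_2: "zmul (- 2) g = - g + - g"
  by (simp add: zmul_minus zmul_2 minus_add del: add_uminus_conv_diff)

lemma bs_words:
  assumes "p + q = zmul n q + p" "x \<in> {q, p, - p, - p + q}" "y \<in> {q, p, - p, - p + q}"
  shows False
proof -
  have "- p + q \<in> bs_forms p q" "- p \<in> bs_forms p q"
    using bs_forms_closed[OF assms(1)] bs_forms_generators by blast+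
  with assms bs_forms_generators show False
    by (intro not_baumslag_solitar[OF assms(1)]) auto
qed

lemma solvable_words:
  assumes "w \<in> set (solvable_words C0 C1 C2)"
  shows "disp s w \<noteq> 0"
proof -
  have 1: "x + x \<noteq> 0" "x + (x + x) \<noteq> 0" "x + (x + (x + x)) \<noteq> 0"
    using torsion x_nonzero by blast+
  have 2: "x + y \<noteq> 0"
    using not_commute by (metis add.assoc add_0 add_right_cancel)
  have 3: "x + (x + y) \<noteq> 0"
    using not_commute by (metis add_diff_cancel diff_minus_eq_add minus_diff_eq neg_eq_iff_add_eq_0)
  have 4: "x + (x + (x + y)) \<noteq> 0"
  proof
    assume "x + (x + (x + y)) = 0"
    then have "y = - (x + (x + x))"
      by (metis add.assoc neg_eq_iff_add_eq_0)
    then show False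
      using not_commute by (simp add: minus_add add.assoc del: add_uminus_conv_diff)
  qed
  have 5: "x + (- y + (- x + y)) \<noteq> 0"
  proof
    assume "x + (- y + (- x + y)) = 0"
    then have "- (x + - y) = - x + y"
      unfolding neg_eq_iff_add_eq_0 by (simp only: add.assoc)
    then have "y + - x = - x + y"
      by (simp only: minus_add minus_minus)
    then have "x + (y + - x) + x = x + (- x + y) + x"
      by simp
    then show False
      using not_commute by (simp add: add.assoc del: add_uminus_conv_diff)
  qed
  have 6: "x + (y + (x + y)) \<noteq> 0"
    using torsion(1)[of "x + y"] 2 unfolding add.assoc by blast
  have 7: "x + (y + (- x + y)) \<noteq> 0"
  proof
    assume "x + (y + (- x + y)) = 0"
    then have "x + y = zmul (- 1) y + x"
      unfolding zmul_minus_1 by (metis add.inverse_distrib_swap add_eq_0_iff diff_add_cancel diff_conv_add_uminus)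
    then show False
      by (rule bs_words) auto
  qed
  \<comment> \<open>With \<open>q = x + y\<close> this is the Klein bottle relation
    \<open>x + q = - q + x\<close>.\<close>
  have 8: "x + (x + (y + y)) \<noteq> 0"
  proof
    assume "x + (x + (y + y)) = 0"
    then have "x + (x + y) = zmul (- 1) (x + y) + x"
      unfolding zmul_minus_1 by (metis add.assoc eq_neg_iff_add_eq_0)
    then show False
      by (rule bs_words) auto
  qed
  have 9: "x + (x + (- y + (- x + y))) \<noteq> 0"
  proof
    assume "x + (x + (- y + (- x + y))) = 0"
    then have "- y + x = zmul 2 x + - y"
      unfolding zmul_2 by (metis (no_types, lifting) add.assoc diff_minus_eq_add eq_neg_iff_add_eq_0 minus_diff_eq)
    then show False
      by (rule bs_words) auto
  qed
  have 10: "x + (x + (- y + (x + y))) \<noteq> 0"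
  proof
    assume "x + (x + (- y + (x + y))) = 0"
    then have "- y + x = zmul (- 2) x + - y"
      unfolding zmul_minus_2 by (metis (no_types, lifting) add.assoc add_diff_cancel add_eq_0_iff diff_minus_eq_add)
    then show False
      by (rule bs_words) auto
  qed
  have 11: "x + (y + (x + (- y + x))) \<noteq> 0"
  proof
    assume "x + (y + (x + (- y + x))) = 0"
    then have "y + x = zmul (- 2) x + y"
      unfolding zmul_minus_2 by (metis (no_types, lifting) add.assoc add_minus_cancel eq_neg_iff_add_eq_0)
    then show False
      by (rule bs_words) auto
  qed
  have 12: "x + (y + (- x + (- y + x))) \<noteq> 0"
  proof
    assume "x + (y + (- x + (- y + x))) = 0"
    then have "y + x = zmul 2 x + y"
      unfolding zmul_2 by (metis (no_types, lifting) add.assoc add_minus_cancel eq_neg_iff_add_eq_0)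
    then show False
      by (rule bs_words) auto
  qed
  show ?thesis
    unfolding disp_xy using assms 1 2 3 4 5 6 7 8 9 10 11 12 x_nonzero
    by (auto simp: solvable_words_def add.assoc minus_add simp del: add_uminus_conv_diff)
qed

text \<open>The words are the five other arrangements of \<open>word_D\<close> and the three of
  \<open>word_H\<close>. Each of their relations contradicts the first, given
  \<open>not_commute\<close> and the absence of elements of order 2 and 3.\<close>

lemma word_D_unique:
  assumes "disp s (word_D C0 C1 C2) = 0"
    and "w \<in> {word_D C0 C2 C1, word_D C1 C0 C2, word_D C1 C2 C0, word_D C2 C0 C1, word_D C2 C1 C0, word_H C0 C1 C2, word_H C0 C2 C1, word_H C1 C2 C0}"
  shows "disp s w \<noteq> 0"
proof -
  have eq: "x + (x + (y + (- x + y))) = 0"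
    using assms(1) unfolding disp_xy by (simp add: word_D_def add.assoc minus_add del: add_uminus_conv_diff)
  have 1: "y + (y + (x + (- y + x))) \<noteq> 0"
    using eq torsion(1,2) not_commute by (smt (verit) ab_left_minus add.assoc add.inverse_neutral add.right_inverse add_left_cancel add_minus_cancel eq_neg_iff_add_eq_0 minus_add_cancel neg_eq_iff_add_eq_0)
  have 2: "- x + (- x + (- x + (y + y))) \<noteq> 0"
    using eq torsion(1,2) not_commute by (metis (no_types, lifting) add.assoc add.right_neutral minus_add_cancel)
  have 3: "- x + (y + (- x + (y + (- x + - y)))) \<noteq> 0"
    using eq torsion(1,2) not_commute by (smt (verit, del_insts) add.assoc eq_neg_iff_add_eq_0 neg_eq_iff_add_eq_0)
  have 4: "- y + (- y + (- y + (x + x))) \<noteq> 0"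
    using eq torsion(1,2) not_commute by (metis (no_types, lifting) add.assoc add_minus_cancel eq_neg_iff_add_eq_0)
  have 5: "- y + (x + (- y + (x + (- y + - x)))) \<noteq> 0"
    using eq torsion(1,2) not_commute by (metis (no_types, lifting) add.assoc add.inverse_distrib_swap eq_neg_iff_add_eq_0 neg_eq_iff_add_eq_0)
  have 6: "x + (y + (- x + (- x + y))) \<noteq> 0"
    using eq torsion(1,2) not_commute by (metis (no_types, lifting) add.assoc add.right_neutral minus_add_cancel)
  have 7: "y + (x + (- y + (- y + x))) \<noteq> 0"
    using eq torsion(1,2) not_commute by (smt (verit) add.assoc add.inverse_distrib_swap eq_neg_iff_add_eq_0)
  have 8: "- x + (y + (- x + (- y + (x + - y)))) \<noteq> 0"
    using eq torsion(1,2) not_commute by (metis (no_types, lifting) add.assoc add.inverse_distrib_swap eq_neg_iff_add_eq_0 neg_eq_iff_add_eq_0)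
  show ?thesis
    unfolding disp_xy using assms(2) 1 2 3 4 5 6 7 8
    by (auto simp: word_D_def word_H_def add.assoc minus_add simp del: add_uminus_conv_diff)
qed

text \<open>Only \<open>word_H\<close> occurs here because the final case distinction turns to it
  after all arrangements of \<open>word_D\<close> are excluded.\<close>

lemma word_H_unique:
  assumes "disp s (word_H C0 C1 C2) = 0"
    and "w \<in> {word_H C0 C2 C1, word_H C1 C2 C0}"
  shows "disp s w \<noteq> 0"
proof -
  have eq: "x + (y + (- x + (- x + y))) = 0"
    using assms(1) unfolding disp_xy by (simp add: word_H_def add.assoc minus_add del: add_uminus_conv_diff)
  have 1: "y + (x + (- y + (- y + x))) \<noteq> 0"
    using eq torsion(1,2) not_commute by (smt (verit) ab_left_minus add.assoc add.inverse_distrib_swap neg_eq_iff_add_eq_0)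
  have 2: "- x + (y + (- x + (- y + (x + - y)))) \<noteq> 0"
    using eq torsion(1,2) not_commute by (smt (verit) ab_left_minus add.assoc add.inverse_distrib_swap neg_eq_iff_add_eq_0)
  show ?thesis
    unfolding disp_xy using assms(2) 1 2
    by (auto simp: word_D_def word_H_def add.assoc minus_add simp del: add_uminus_conv_diff)
qed

end

section \<open>The search for small graphs\<close>

text \<open>A half-edge \<open>(b, i)\<close> stands for the product of colour \<open>i\<close> with
  vertex \<open>b\<close>. A walk keeps its last vertex, the colour of arrival there, and its
  word.\<close>

type_synonym half_edge = "nat \<times> colour"
type_synonym walk = "half_edge \<times> colour list"

text \<open>A partial graph is a list of rows, one for each known vertex; the three entries of row \<open>b\<close> list, for each
  colour \<open>i\<close>, the half-edges \<open>(c, j)\<close> known to satisfy \<open>s j + c = s i + b\<close> in the group.\<close>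

datatype row = Row "half_edge list" "half_edge list" "half_edge list"

fun entry :: "row \<Rightarrow> colour \<Rightarrow> half_edge list" where
  "entry (Row x y z) C0 = x" | "entry (Row x y z) C1 = y" | "entry (Row x y z) C2 = z"

fun add_entry :: "row \<Rightarrow> colour \<Rightarrow> half_edge list \<Rightarrow> row" where
  "add_entry (Row x y z) C0 hs = Row (hs @ x) y z"
| "add_entry (Row x y z) C1 hs = Row x (hs @ y) z"
| "add_entry (Row x y z) C2 hs = Row x y (hs @ z)"

fun mates :: "row list \<Rightarrow> nat \<Rightarrow> colour \<Rightarrow> half_edge list" where
  "mates [] b i = []"
| "mates (r # rs) 0 i = entry r i"
| "mates (r # rs) (Suc b) i = mates rs b i"

fun link :: "row list \<Rightarrow> nat \<Rightarrow> colour \<Rightarrow> half_edge list \<Rightarrow> row list" where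
  "link [] b i hs = []"
| "link (r # rs) 0 i hs = add_entry r i hs # rs"
| "link (r # rs) (Suc b) i hs = r # link rs b i hs"

fun link_all :: "half_edge list \<Rightarrow> half_edge list \<Rightarrow> row list \<Rightarrow> row list" where
  "link_all [] hs rs = rs"
| "link_all (g # gs) hs rs = link_all gs hs (link rs (fst g) (snd g) hs)"

text \<open>The list \<open>gs\<close> is to be a whole class of equal products; entering
  \<open>h\<close> at each member keeps the entries complete classes.\<close>

fun join :: "row list \<Rightarrow> half_edge \<Rightarrow> half_edge list \<Rightarrow> row list" where
  "join rs h gs = link_all gs [h] (link rs (fst h) (snd h) gs)"

fun merges :: "nat \<Rightarrow> row list \<Rightarrow> half_edge \<Rightarrow> half_edge list \<Rightarrow> (nat \<times> row list) list" where
  "merges r rs h [] = []"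
| "merges r rs h (g # gs) = (r, join rs h (g # mates rs (fst g) (snd g))) # merges r rs h gs"

fun extends :: "nat \<Rightarrow> row list \<Rightarrow> half_edge \<Rightarrow> nat \<Rightarrow> colour list \<Rightarrow> (nat \<times> row list) list" where
  "extends r rs h k [] = []"
| "extends r rs h k (j # js) =
    (r, link rs (fst h) (snd h) [(k, j)] @ [add_entry (Row [] [] []) j [h]]) # extends r rs h k js"

fun third :: "colour \<Rightarrow> colour \<Rightarrow> colour list" where
  "third C0 C0 = [C1, C2]" | "third C0 C1 = [C2]" | "third C0 C2 = [C1]"
| "third C1 C0 = [C2]" | "third C1 C1 = [C0, C2]" | "third C1 C2 = [C0]"
| "third C2 C0 = [C1]" | "third C2 C1 = [C0]" | "third C2 C2 = [C0, C1]"

lemma set_third: "set (third i j) = UNIV - {i, j}"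
  by (cases i; cases j) (auto simp: UNIV_colour)

fun elem :: "'a \<Rightarrow> 'a list \<Rightarrow> bool" where
  "elem j [] = False"
| "elem j (k # ks) = (if j = k then True else elem j ks)"

lemma elem_iff: "elem j ks \<longleftrightarrow> j \<in> set ks"
  by (induction ks) auto

fun member :: "'a list \<Rightarrow> 'a list list \<Rightarrow> bool" where
  "member w [] = False"
| "member w (v # vs) = (if same w v then True else member w vs)"

lemma member_iff: "member w vs \<longleftrightarrow> w \<in> set vs"
  by (induction vs) (auto simp: same_iff)

fun drop_all :: "'a list \<Rightarrow> 'a list \<Rightarrow> 'a list" where
  "drop_all [] ks = ks"
| "drop_all (j # js) ks = drop_all js (removeAll j ks)"

lemma set_drop_all: "set (drop_all js ks) = set ks - set js"
  by (induction js ks rule: drop_all.induct) auto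

fun strike :: "nat \<Rightarrow> 'a list \<Rightarrow> 'a list list \<Rightarrow> 'a list list" where
  "strike c js [] = []"
| "strike 0 js (ks # T) = drop_all js ks # T"
| "strike (Suc c) js (ks # T) = ks # strike c js T"

fun available :: "'a list list \<Rightarrow> nat \<Rightarrow> 'a \<Rightarrow> bool" where
  "available [] c j = False"
| "available (ks # T) 0 j = elem j ks"
| "available (ks # T) (Suc c) j = available T c j"

lemma available_strike: "available (strike c js T) d j \<longleftrightarrow> available T d j \<and> (d = c \<longrightarrow> j \<notin> set js)"
proof (induction T arbitrary: c d)
  case (Cons ks T)
  then show ?case
    by (cases c; cases d) (auto simp: elem_iff set_drop_all)
qed simp

fun initial :: "'a list \<Rightarrow> 'b list \<Rightarrow> 'a list list" where
  "initial js [] = []"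
| "initial js (r # rs) = js # initial js rs"

lemma available_initial: "available (initial js rs) c j \<longleftrightarrow> c < length rs \<and> j \<in> set js"
proof (induction rs arbitrary: c)
  case (Cons r rs)
  then show ?case by (cases c) (auto simp: elem_iff)
qed simp

fun unless_allowed :: "colour list list \<Rightarrow> colour \<Rightarrow> colour list \<Rightarrow> colour list \<Rightarrow> colour list" where
  "unless_allowed al i w [] = []"
| "unless_allowed al i w (j # js) =
    (if member (i # j # w) al then unless_allowed al i w js else j # unless_allowed al i w js)"

lemma set_unless_allowed: "set (unless_allowed al i w js) = {j \<in> set js. i # j # w \<notin> set al}"
  by (induction js) (auto simp: member_iff)

text \<open>Merging \<open>(c, j)\<close> with the chosen half-edge closes the walk to the word
  \<open>i # j # w\<close> of length \<open>8 - 2 * n\<close>. Only words of length 8 can be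
  admissible, so for positive \<open>n\<close> every colour that gives a reduced word is
  struck.\<close>

fun closing :: "colour list list \<Rightarrow> nat \<Rightarrow> colour \<Rightarrow> colour \<Rightarrow> colour list \<Rightarrow> colour list" where
  "closing al 0 i e w = unless_allowed al i w (third i e)"
| "closing al (Suc n) i e w = third i e"

fun arrivals :: "colour list \<Rightarrow> colour \<Rightarrow> half_edge list \<Rightarrow> walk list \<Rightarrow> walk list" where
  "arrivals w a [] ws = ws"
| "arrivals w a (h # hs) ws = (h, snd h # a # w) # arrivals w a hs ws"

fun departures :: "row list \<Rightarrow> nat \<Rightarrow> colour list \<Rightarrow> colour list \<Rightarrow> walk list \<Rightarrow> walk list" where
  "departures rs c w [] ws = ws"
| "departures rs c w (a # as) ws = arrivals w a (mates rs c a) (departures rs c w as ws)"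

text \<open>Leaving by a colour other than that of arrival keeps the words reduced.\<close>

fun prolong :: "row list \<Rightarrow> walk list \<Rightarrow> walk list" where
  "prolong rs [] = []"
| "prolong rs (((c, e), w) # ws) = departures rs c w (others e) (prolong rs ws)"

fun strike_all :: "colour list list \<Rightarrow> nat \<Rightarrow> colour \<Rightarrow> walk list \<Rightarrow> colour list list \<Rightarrow> colour list list" where
  "strike_all al n i [] T = T"
| "strike_all al n i (((c, e), w) # ws) T = strike_all al n i ws (strike c (closing al n i e w) T)"

text \<open>Entry \<open>c\<close> of the table holds the colours \<open>j\<close> for which merging \<open>(c, j)\<close> with the chosen half-edge is not
  yet excluded by a short closed walk.\<close>

fun explore :: "colour list list \<Rightarrow> row list \<Rightarrow> colour \<Rightarrow> nat \<Rightarrow> walk list \<Rightarrow> colour list list \<Rightarrow> colour list list" where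
  "explore al rs i 0 ws T = strike_all al 0 i ws T"
| "explore al rs i (Suc n) ws T = explore al rs i n (prolong rs ws) (strike_all al (Suc n) i ws T)"

text \<open>When a half-edge is merged with a class of two half-edges, only the one of smaller colour is tried, because
  the other one gives the same graph.\<close>

fun before :: "colour \<Rightarrow> colour \<Rightarrow> bool" where
  "before C0 l = (case l of C0 \<Rightarrow> False | _ \<Rightarrow> True)"
| "before C1 l = (case l of C2 \<Rightarrow> True | _ \<Rightarrow> False)"
| "before C2 l = False"

fun mergeable :: "colour list list \<Rightarrow> colour \<Rightarrow> half_edge list \<Rightarrow> bool" where
  "mergeable T j [] = True"
| "mergeable T j (h # hs) =
    (if before j (snd h) then if available T (fst h) (snd h) then mergeable T j hs else False else False)"

lemma mergeable_iff: "mergeable T j hs \<longleftrightarrow> (\<forall>(d, l)\<in>set hs. before j l \<and> available T d l)"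
  by (induction hs) auto

fun row_candidates :: "colour list list \<Rightarrow> nat \<Rightarrow> row \<Rightarrow> colour list \<Rightarrow> half_edge list \<Rightarrow> half_edge list" where
  "row_candidates T c r [] hs = hs"
| "row_candidates T c r (j # js) hs =
    (if mergeable T j (entry r j) then (c, j) # row_candidates T c r js hs else row_candidates T c r js hs)"

fun select_candidates :: "colour list list \<Rightarrow> nat \<Rightarrow> row list \<Rightarrow> colour list list \<Rightarrow> half_edge list" where
  "select_candidates T c (r # rs) (ks # K) = row_candidates T c r ks (select_candidates T (Suc c) rs K)"
| "select_candidates T c rs K = []"

fun table_candidates :: "row list \<Rightarrow> colour list list \<Rightarrow> half_edge list" where
  "table_candidates rs T = select_candidates T 0 rs T"

text \<open>Walks of up to 3 steps suffice: the merger adds a fourth, which reaches length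
  8.\<close>

definition candidates :: "colour list list \<Rightarrow> row list \<Rightarrow> half_edge \<Rightarrow> half_edge list" where
  "candidates al rs h = table_candidates rs (explore al rs (snd h) 3 [(h, [])] (initial (others (snd h)) rs))"

lemma set_row_candidates:
  "set (row_candidates T c r js hs) = {(c, j) | j. j \<in> set js \<and> mergeable T j (entry r j)} \<union> set hs"
  by (induction T c r js hs rule: row_candidates.induct) auto

lemma set_select_candidates:
  "(a, j) \<in> set (select_candidates T c rs K) \<longleftrightarrow>
    c \<le> a \<and> a - c < length rs \<and> available K (a - c) j \<and> mergeable T j (mates rs (a - c) j)"
proof (induction T c rs K rule: select_candidates.induct)
  case (1 T c r rs ks K)
  show ?case
  proof (cases "a - c")
    case 0
    then show ?thesis using 1 by (auto simp: set_row_candidates elem_iff)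
  next
    case (Suc m)
    then have "a - Suc c = m" "c \<noteq> a" "c \<le> a" "Suc c \<le> a" by auto
    then show ?thesis using 1 Suc by (auto simp: set_row_candidates)
  qed
qed auto

fun pend :: "half_edge list \<Rightarrow> half_edge \<Rightarrow> half_edge list \<Rightarrow> half_edge list" where
  "pend [] h hs = h # hs"
| "pend (g # gs) h hs = hs"

fun pending :: "nat \<Rightarrow> row list \<Rightarrow> half_edge list" where
  "pending b [] = []"
| "pending b (Row x y z # rs) = pend x (b, C0) (pend y (b, C1) (pend z (b, C2) (pending (Suc b) rs)))"

lemma set_pend: "set (pend gs h hs) = (if gs = [] then insert h (set hs) else set hs)"
  by (cases gs) auto

lemma set_pending: "(a, i) \<in> set (pending b rs) \<Longrightarrow> b \<le> a \<and> a - b < length rs \<and> mates rs (a - b) i = []"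
proof (induction b rs rule: pending.induct)
  case (2 b x y z rs)
  then consider "a = b" "entry (Row x y z) i = []" | "(a, i) \<in> set (pending (Suc b) rs)"
    by (auto simp: set_pend split: if_splits)
  then show ?case
  proof cases
    case 2
    with "2.IH" have "Suc b \<le> a" "a - Suc b < length rs" "mates rs (a - Suc b) i = []" by auto
    moreover from this obtain m where "a - b = Suc m" "a - Suc b = m"
      by (metis Suc_diff_le diff_Suc_Suc)
    ultimately show ?thesis by auto
  qed auto
qed simp

text \<open>Any half-edge without a known partner may be chosen for branching; preferring one with few candidates
  only keeps the search small.\<close>

fun short :: "nat \<Rightarrow> 'a list \<Rightarrow> bool" where
  "short n [] = True"
| "short 0 (x # xs) = False"
| "short (Suc n) (x # xs) = short n xs"

fun shorter :: "'a list \<Rightarrow> 'b list \<Rightarrow> bool" where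
  "shorter [] ys = True"
| "shorter (x # xs) [] = False"
| "shorter (x # xs) (y # ys) = shorter xs ys"

fun better :: "half_edge \<Rightarrow> half_edge list \<Rightarrow> half_edge \<Rightarrow> half_edge list \<Rightarrow> half_edge \<times> half_edge list" where
  "better h ws g vs = (if shorter vs ws then (g, vs) else (h, ws))"

fun best :: "nat \<Rightarrow> colour list list \<Rightarrow> row list \<Rightarrow> half_edge list \<Rightarrow> half_edge \<times> half_edge list \<Rightarrow> half_edge \<times> half_edge list" where
  "best t al rs [] (g, vs) = (g, vs)"
| "best t al rs (h # hs) (g, vs) =
    (if short t vs then (g, vs) else best t al rs hs (better h (candidates al rs h) g vs))"

lemma best:
  assumes "vs = candidates al rs g" "best t al rs hs (g, vs) = (h, ws)"
  shows "ws = candidates al rs h \<and> h \<in> insert g (set hs)"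
  using assms
  by (induction t al rs hs "(g, vs)" arbitrary: g vs rule: best.induct) (auto split: if_splits)

text \<open>Without room for new vertices one candidate means no branching, so it is good enough;
  otherwise only an empty list ends the comparison early.\<close>

fun threshold :: "nat \<Rightarrow> nat" where
  "threshold 0 = 1"
| "threshold (Suc r) = 0"

fun branches :: "nat \<Rightarrow> row list \<Rightarrow> half_edge \<times> half_edge list \<Rightarrow> (nat \<times> row list) list" where
  "branches 0 rs (h, ws) = merges 0 rs h ws"
| "branches (Suc r) rs (h, ws) = extends r rs h (length rs) (others (snd h)) @ merges (Suc r) rs h ws"

text \<open>A graph in which every half-edge has a partner is its own child; it is never refuted, as
  the depth runs out.\<close>

fun children :: "colour list list \<Rightarrow> nat \<Rightarrow> row list \<Rightarrow> half_edge list \<Rightarrow> (nat \<times> row list) list" where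
  "children al r rs [] = [(r, rs)]"
| "children al r rs (h # hs) = branches r rs (best (threshold r) al rs hs (h, candidates al rs h))"

fun every :: "('a \<Rightarrow> bool) \<Rightarrow> 'a list \<Rightarrow> bool" where
  "every P [] = True"
| "every P (x # xs) = (if P x then every P xs else False)"

lemma every_iff: "every P xs \<longleftrightarrow> (\<forall>x\<in>set xs. P x)"
  by (induction xs) auto

text \<open>The first argument lists the admissible closed walks of length 8, the second bounds the depth, and a state
  consists of the number of vertices that may still be added and a partial graph.\<close>

fun refutes :: "colour list list \<Rightarrow> nat \<Rightarrow> nat \<times> row list \<Rightarrow> bool" where
  "refutes al 0 x = False"
| "refutes al (Suc n) (r, rs) = every (refutes al n) (children al r rs (pending 0 rs))"

section \<open>Soundness of the search\<close>

lemma length_link [simp]: "length (link rs b i hs) = length rs"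
  by (induction rs b i hs rule: link.induct) auto

lemma entry_add_entry: "entry (add_entry r i hs) j = (if j = i then hs @ entry r j else entry r j)"
  by (cases r; cases i; cases j) auto

lemma mates_link:
  "mates (link rs b i hs) c j = (if c = b \<and> j = i \<and> b < length rs then hs @ mates rs c j else mates rs c j)"
proof (induction rs arbitrary: b c)
  case (Cons r rs)
  then show ?case by (cases b; cases c) (auto simp: entry_add_entry)
qed simp

lemma length_link_all [simp]: "length (link_all gs hs rs) = length rs"
  by (induction gs hs rs rule: link_all.induct) auto

lemma set_mates_link_all:
  "set (mates (link_all gs hs rs) c j) = set (mates rs c j) \<union> (if (c, j) \<in> set gs \<and> c < length rs then set hs else {})"
  by (induction gs hs rs rule: link_all.induct) (auto simp: mates_link)

lemma set_mates_join:
  "set (mates (join rs (b, i) gs) c j) = set (mates rs c j)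
     \<union> (if (c, j) = (b, i) \<and> b < length rs then set gs else {}) \<union> (if (c, j) \<in> set gs \<and> c < length rs then {(b, i)} else {})"
  by (auto simp: set_mates_link_all mates_link)

lemma set_mates_joinD:
  "h \<in> set (mates (join rs (b, i) gs) c j) \<Longrightarrow>
    h \<in> set (mates rs c j) \<or> (c, j) = (b, i) \<and> h \<in> set gs \<or> (c, j) \<in> set gs \<and> h = (b, i)"
  unfolding set_mates_join by (auto split: if_splits)

lemma mates_append:
  "mates (rs @ [r]) c j = (if c < length rs then mates rs c j else if c = length rs then entry r j else [])"
proof (induction rs arbitrary: c)
  case Nil
  show ?case by (cases c) auto
next
  case (Cons r rs)
  then show ?case by (cases c) auto
qed

lemma entry_add_entry_empty: "entry (add_entry (Row [] [] []) j hs) k = (if k = j then hs else [])"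
  by (cases j; cases k) auto

lemma set_arrivals: "set (arrivals w a hs ws) = {((d, l), l # a # w) | d l. (d, l) \<in> set hs} \<union> set ws"
  by (induction w a hs ws rule: arrivals.induct) auto

lemma set_departures:
  "set (departures rs c w as ws) = {((d, l), l # a # w) | a d l. a \<in> set as \<and> (d, l) \<in> set (mates rs c a)} \<union> set ws"
  by (induction rs c w as ws rule: departures.induct) (auto simp: set_arrivals)

lemma set_prolong:
  assumes "z \<in> set (prolong rs ws)"
  shows "\<exists>c e w a d l. z = ((d, l), l # a # w) \<and> ((c, e), w) \<in> set ws \<and> a \<noteq> e \<and> (d, l) \<in> set (mates rs c a)"
  using assms
proof (induction rs ws rule: prolong.induct)
  case (2 rs c e w ws)
  have "z \<in> {((d, l), l # a # w) | a d l. a \<in> - {e} \<and> (d, l) \<in> set (mates rs c a)} \<union> set (prolong rs ws)"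
    using "2.prems" unfolding prolong.simps set_departures set_others Compl_eq_Diff_UNIV .
  then consider "z \<in> set (prolong rs ws)"
    | a d l where "z = ((d, l), l # a # w)" "a \<noteq> e" "(d, l) \<in> set (mates rs c a)"
    by blast
  then show ?case
  proof cases
    case 1
    then show ?thesis
      using "2.IH" by fastforce
  next
    case 2
    then show ?thesis by auto
  qed
qed simp

fun rank :: "colour \<Rightarrow> nat" where
  "rank C0 = 0" | "rank C1 = 1" | "rank C2 = 2"

lemma before_iff: "before i j \<longleftrightarrow> rank i < rank j"
  by (cases i; cases j) auto

lemma rank_eq_iff: "rank i = rank j \<longleftrightarrow> i = j"
  by (cases i; cases j) auto

context no_unique_product
begin

text \<open>Not all coincidences need be known. The last clause ensures that a half-edge without
  partners is no partner of another one.\<close>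

definition represents :: "(nat \<Rightarrow> 'g) \<Rightarrow> row list \<Rightarrow> bool" where
  "represents f rs \<longleftrightarrow> inj_on f {..<length rs} \<and> f ` {..<length rs} \<subseteq> B \<and>
    (\<forall>b i c j. (c, j) \<in> set (mates rs b i) \<longrightarrow>
       c < length rs \<and> j \<noteq> i \<and> s i + f b = s j + f c \<and> mates rs c j \<noteq> [])"

lemma representsI:
  assumes "length rs = n" "inj_on f {..<n}" "f ` {..<n} \<subseteq> B"
    and "\<And>b i c j. (c, j) \<in> set (mates rs b i) \<Longrightarrow>
      c < n \<and> j \<noteq> i \<and> s i + f b = s j + f c \<and> mates rs c j \<noteq> []"
  shows "represents f rs"
  using assms unfolding represents_def by simp

lemma represents_mates:
  assumes "represents f rs" "(c, j) \<in> set (mates rs b i)"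
  shows "c < length rs" "j \<noteq> i" "s i + f b = s j + f c" "mates rs c j \<noteq> []"
  using assms unfolding represents_def by blast+

text \<open>Appending \<open>snd h\<close> gives the empty walk the chosen colour as its colour of
  arrival and anticipates the cyclic condition on the closed word.\<close>

definition valid_walk :: "(nat \<Rightarrow> 'g) \<Rightarrow> row list \<Rightarrow> half_edge \<Rightarrow> walk \<Rightarrow> bool" where
  "valid_walk f rs h z \<longleftrightarrow> fst (fst z) < length rs \<and> f (fst (fst z)) = disp s (snd z) + f (fst h) \<and>
     even (length (snd z)) \<and> distinct_adj (snd z @ [snd h]) \<and> hd (snd z @ [snd h]) = snd (fst z)"

lemma valid_walk_prolong:
  assumes "represents f rs" "\<And>z. z \<in> set ws \<Longrightarrow> valid_walk f rs h z \<and> length (snd z) = n"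
    and "z \<in> set (prolong rs ws)"
  shows "valid_walk f rs h z \<and> length (snd z) = Suc (Suc n)"
proof -
  obtain c e w a d l where z: "z = ((d, l), l # a # w)" "((c, e), w) \<in> set ws" "a \<noteq> e" "(d, l) \<in> set (mates rs c a)"
    using set_prolong[OF assms(3)] by blast
  have w: "valid_walk f rs h ((c, e), w)" "length w = n"
    using assms(2)[OF z(2)] by auto
  note m = represents_mates[OF assms(1) z(4)]
  have "f d = - s l + (s a + f c)"
    using m(3) by simp
  moreover have "distinct_adj (a # w @ [snd h])"
    using w(1) z(3) by (auto simp: valid_walk_def distinct_adj_Cons)
  ultimately show ?thesis
    using w m(1,2) by (auto simp: z(1) valid_walk_def add.assoc)
qed

definition same_product :: "(nat \<Rightarrow> 'g) \<Rightarrow> half_edge \<Rightarrow> half_edge \<Rightarrow> bool" where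
  "same_product f h g \<longleftrightarrow> s (snd g) + f (fst g) = s (snd h) + f (fst h)"

definition sound_table :: "(nat \<Rightarrow> 'g) \<Rightarrow> row list \<Rightarrow> half_edge \<Rightarrow> colour list list \<Rightarrow> bool" where
  "sound_table f rs h T \<longleftrightarrow>
    (\<forall>c<length rs. \<forall>j. j \<noteq> snd h \<longrightarrow> same_product f h (c, j) \<longrightarrow> available T c j)"

definition only_relators :: "colour list list \<Rightarrow> bool" where
  "only_relators al \<longleftrightarrow>
    (\<forall>w. cyclic_word w \<longrightarrow> length w \<le> 8 \<longrightarrow> disp s w = 0 \<longrightarrow> length w = 8 \<and> w \<in> set al)"

text \<open>A coincidence would close the walk to a cyclic word of displacement 0 that
  \<open>only_relators\<close> forbids.\<close>

lemma closing_sound: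
  assumes al: "only_relators al" and walk: "valid_walk f rs h ((c, e), w)" and len: "length w + 2 * n = 6"
    and j: "j \<in> set (closing al n (snd h) e w)"
  shows "\<not> same_product f h (c, j)"
proof
  assume "same_product f h (c, j)"
  then have eq: "f (fst h) = - s (snd h) + (s j + f c)"
    by (simp add: same_product_def)
  let ?v = "snd h # j # w"
  have j': "j \<noteq> snd h" "j \<noteq> e" "n = 0 \<Longrightarrow> ?v \<notin> set al"
    using j by (cases n; auto simp: set_third set_unless_allowed)+
  have "disp s ?v + f (fst h) = f (fst h)"
    using walk eq by (simp add: valid_walk_def add.assoc)
  then have "disp s ?v = 0"
    by (metis add_0_left add_right_cancel)
  moreover have "cyclic_word ?v"
    using walk j' by (auto simp: cyclic_word_def valid_walk_def distinct_adj_Cons)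
  moreover have "length ?v \<le> 8"
    using len by simp
  ultimately have "length ?v = 8" "?v \<in> set al"
    using al unfolding only_relators_def by blast+
  with len j' show False by simp
qed

lemma strike_all_sound:
  assumes "only_relators al" "sound_table f rs h T"
    and "\<And>z. z \<in> set ws \<Longrightarrow> valid_walk f rs h z \<and> length (snd z) + 2 * n = 6"
  shows "sound_table f rs h (strike_all al n (snd h) ws T)"
  using assms(2,3)
proof (induction ws arbitrary: T)
  case (Cons z ws)
  obtain c e w where z: "z = ((c, e), w)"
    by (metis prod.exhaust)
  have "sound_table f rs h (strike c (closing al n (snd h) e w) T)"
    using Cons.prems(1) Cons.prems(2)[of z] closing_sound[OF assms(1), of f rs h c e w n]
    by (auto simp: z sound_table_def available_strike)
  with Cons show ?case
    by (simp add: z)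
qed simp

lemma explore_sound:
  assumes "only_relators al" "represents f rs" "n \<le> 3" "sound_table f rs h T"
    and "\<And>z. z \<in> set ws \<Longrightarrow> valid_walk f rs h z \<and> length (snd z) = 6 - 2 * n"
  shows "sound_table f rs h (explore al rs (snd h) n ws T)"
  using assms(3-5)
proof (induction n arbitrary: ws T)
  case 0
  then show ?case
    using strike_all_sound[OF assms(1), of f rs h T ws 0] by simp
next
  case (Suc n)
  have "sound_table f rs h (strike_all al (Suc n) (snd h) ws T)"
    using Suc.prems by (intro strike_all_sound[OF assms(1)]) auto
  moreover have "valid_walk f rs h z \<and> length (snd z) = 6 - 2 * n" if "z \<in> set (prolong rs ws)" for z
    using valid_walk_prolong[OF assms(2) Suc.prems(3) that] Suc.prems(1) by auto
  ultimately show ?case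
    using Suc.IH Suc.prems(1) by simp
qed

text \<open>The partners of \<open>(c, j)\<close> share its product. Colour \<open>i\<close> among
  them would give \<open>d = b\<close> by injectivity, but \<open>(b, i)\<close> has no known
  partner.\<close>

lemma mates_of_partner:
  assumes "represents f rs" "b < length rs" "mates rs b i = []" "same_product f (b, i) (c, j)" "(d, l) \<in> set (mates rs c j)"
  shows "d < length rs" "l \<noteq> i" "l \<noteq> j" "same_product f (b, i) (d, l)"
proof -
  note m = represents_mates[OF assms(1,5)]
  show *: "d < length rs" "l \<noteq> j" "same_product f (b, i) (d, l)"
    using m assms(4) by (auto simp: same_product_def)
  show "l \<noteq> i"
  proof
    assume "l = i"
    with * have "f d = f b"
      by (simp add: same_product_def)
    then have "d = b"
      using assms(1,2) * by (auto simp: represents_def inj_on_def)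
    with m(4) assms(3) \<open>l = i\<close> show False by simp
  qed
qed

text \<open>The half-edge found may differ from the given one: a coincident half-edge of least
  colour is taken. All its partners are coincident too and have larger colours, so it passes
  \<open>mergeable\<close>.\<close>

lemma candidates_complete:
  assumes al: "only_relators al" and rs: "represents f rs" and b: "b < length rs" "mates rs b i = []"
    and c: "c < length rs" "j \<noteq> i" "same_product f (b, i) (c, j)"
  shows "\<exists>c j. (c, j) \<in> set (candidates al rs (b, i)) \<and> c < length rs \<and> j \<noteq> i \<and> same_product f (b, i) (c, j)"
proof -
  define T where "T = explore al rs i 3 [((b, i), [])] (initial (others i) rs)"
  have "sound_table f rs (b, i) (initial (others i) rs)"
    by (auto simp: sound_table_def available_initial set_others)
  moreover have "valid_walk f rs (b, i) ((b, i), [])"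
    using b by (simp add: valid_walk_def)
  ultimately have "sound_table f rs (b, i) (explore al rs (snd (b, i)) 3 [((b, i), [])] (initial (others i) rs))"
    by (intro explore_sound[OF al rs]) auto
  then have T: "sound_table f rs (b, i) T"
    unfolding T_def snd_conv .
  let ?Q = "\<lambda>g. fst g < length rs \<and> snd g \<noteq> i \<and> same_product f (b, i) g"
  have "?Q (c, j)"
    using c by simp
  then obtain g where g: "?Q g" "\<And>g'. ?Q g' \<Longrightarrow> rank (snd g) \<le> rank (snd g')"
    using ex_has_least_nat[of ?Q "(c, j)" "\<lambda>g. rank (snd g)"] by blast
  obtain c' j' where g': "g = (c', j')"
    by (metis prod.exhaust)
  have "mergeable T j' (mates rs c' j')"
    unfolding mergeable_iff
  proof safe
    fix d l assume dl: "(d, l) \<in> set (mates rs c' j')"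
    have "same_product f (b, i) (c', j')"
      using g(1) by (simp add: g')
    note d = mates_of_partner[OF rs b this dl]
    then show "available T d l"
      using T by (simp add: sound_table_def)
    have "rank j' \<le> rank l"
      using g(2)[of "(d, l)"] d by (simp add: g')
    with d(3) show "before j' l"
      by (metis before_iff le_neq_implies_less rank_eq_iff)
  qed
  moreover have "available T c' j'"
    using T g(1) by (auto simp: sound_table_def g')
  ultimately show ?thesis
    using g(1) unfolding candidates_def
    by (intro exI[of _ c'] exI[of _ j']) (simp add: g' set_select_candidates T_def)
qed

lemma set_merges: "g \<in> set gs \<Longrightarrow> (r, join rs h (g # mates rs (fst g) (snd g))) \<in> set (merges r rs h gs)"
  by (induction r rs h gs rule: merges.induct) (auto simp del: join.simps)

lemma set_extends:
  "j \<in> set js \<Longrightarrow> (r, link rs (fst h) (snd h) [(k, j)] @ [add_entry (Row [] [] []) j [h]]) \<in> set (extends r rs h k js)"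
  by (induction r rs h k js rule: extends.induct) auto

lemma represents_join:
  assumes rs: "represents f rs" and b: "b < length rs" "mates rs b i = []"
    and c: "c < length rs" "j \<noteq> i" "same_product f (b, i) (c, j)"
  shows "represents f (join rs (b, i) ((c, j) # mates rs c j))" (is "represents f ?rs'")
proof -
  have gs: "d < length rs" "l \<noteq> i" "s i + f b = s l + f d"
    if "(d, l) \<in> set ((c, j) # mates rs c j)" for d l
  proof -
    have "d < length rs \<and> l \<noteq> i \<and> same_product f (b, i) (d, l)"
    proof (cases "(d, l) \<in> set (mates rs c j)")
      case True
      then show ?thesis
        using mates_of_partner[OF rs b c(3)] by blast
    qed (use that c in simp)
    then show "d < length rs" "l \<noteq> i" "s i + f b = s l + f d"
      by (simp_all add: same_product_def)
  qed
  have len: "length ?rs' = length rs"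
    by simp
  note set_mates = set_mates_join[of rs b i "(c, j) # mates rs c j"]
  have "d < length rs \<and> l \<noteq> k \<and> s k + f a = s l + f d \<and> mates ?rs' d l \<noteq> []"
    if d: "(d, l) \<in> set (mates ?rs' a k)" for a k d l
  proof -
    from set_mates_joinD[OF d] consider "(d, l) \<in> set (mates rs a k)"
      | "(a, k) = (b, i)" "(d, l) \<in> set ((c, j) # mates rs c j)"
      | "(a, k) \<in> set ((c, j) # mates rs c j)" "(d, l) = (b, i)"
      by blast
    then show ?thesis
    proof cases
      case 1
      have "set (mates rs d l) \<subseteq> set (mates ?rs' d l)"
        unfolding set_mates by blast
      with represents_mates[OF rs 1] show ?thesis
        by fastforce
    next
      case 2
      have "(b, i) \<in> set (mates ?rs' d l)"
        unfolding set_mates using 2 gs(1)[OF 2(2)] by simp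
      then show ?thesis
        using 2 gs[OF 2(2)] by force
    next
      case 3
      have "(c, j) \<in> set (mates ?rs' b i)"
        unfolding set_mates using b(1) by simp
      then show ?thesis
        using 3 gs[OF 3(1)] b(1) by force
    qed
  qed
  moreover have "inj_on f {..<length rs}" "f ` {..<length rs} \<subseteq> B"
    using rs unfolding represents_def by blast+
  ultimately show ?thesis
    by (intro representsI[OF len])
qed

lemma represents_extend:
  assumes rs: "represents f rs" and b: "b < length rs"
    and v: "v \<in> B" "v \<notin> f ` {..<length rs}" "j \<noteq> i" "s i + f b = s j + v"
  shows "represents (f(length rs := v)) (link rs b i [(length rs, j)] @ [add_entry (Row [] [] []) j [(b, i)]])"
    (is "represents ?f ?rs'")
proof -
  let ?k = "length rs"
  have len: "length ?rs' = Suc ?k"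
    by simp
  have mates: "mates ?rs' a l = (if a = b \<and> l = i then (?k, j) # mates rs a l else if a < ?k then mates rs a l
    else if a = ?k \<and> l = j then [(b, i)] else [])" for a l
    using b by (simp add: mates_append mates_link entry_add_entry_empty)
  have "inj_on ?f {..<Suc ?k}"
    using rs v(2) by (auto simp: represents_def inj_on_def lessThan_Suc)
  moreover have "?f ` {..<Suc ?k} \<subseteq> B"
    using rs v(1) by (auto simp: represents_def lessThan_Suc)
  moreover have "d < Suc ?k \<and> l \<noteq> m \<and> s m + ?f a = s l + ?f d \<and> mates ?rs' d l \<noteq> []"
    if d: "(d, l) \<in> set (mates ?rs' a m)" for a m d l
  proof -
    from d consider "a < ?k" "(d, l) \<in> set (mates rs a m)" | "(a, m) = (b, i)" "(d, l) = (?k, j)"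
      | "(a, m) = (?k, j)" "(d, l) = (b, i)"
      unfolding mates using b by (auto split: if_splits)
    then show ?thesis
    proof cases
      case 1
      then show ?thesis
        using represents_mates[OF rs 1(2)] unfolding mates by auto
    next
      case 2
      then show ?thesis
        using b v unfolding mates by auto
    next
      case 3
      then show ?thesis
        using b v unfolding mates by auto
    qed
  qed
  ultimately show ?thesis
    by (intro representsI[OF len])
qed

definition realised :: "nat \<times> row list \<Rightarrow> bool" where
  "realised z \<longleftrightarrow> card B \<le> length (snd z) + fst z \<and> (\<exists>f. represents f (snd z))"

text \<open>The chosen half-edge has a partner in \<open>B\<close> by \<open>no_unique\<close>. Its
  vertex is either known, which leads to a merger, or new, which leads to an extension.\<close>

lemma children_sound:
  assumes al: "only_relators al" and z: "realised (r, rs)"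
  shows "\<exists>z\<in>set (children al r rs (pending 0 rs)). realised z"
proof (cases "pending 0 rs")
  case Nil
  then show ?thesis using z by simp
next
  case (Cons h hs)
  obtain f where f: "represents f rs" and card: "card B \<le> length rs + r"
    using z by (auto simp: realised_def)
  obtain b i ws where bi: "best (threshold r) al rs hs (h, candidates al rs h) = ((b, i), ws)"
    by (metis prod.exhaust)
  have "(b, i) \<in> set (pending 0 rs)" and ws: "ws = candidates al rs (b, i)"
    using best[OF refl bi] by (auto simp: Cons)
  then have b: "b < length rs" "mates rs b i = []"
    using set_pending[of b i 0 rs] by auto
  then have "f b \<in> B"
    using f by (auto simp: represents_def)
  then obtain j v where v: "j \<noteq> i" "v \<in> B" "s i + f b = s j + v"
    using no_unique by blast
  show ?thesis
  proof (cases "v \<in> f ` {..<length rs}")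
    case True
    then obtain c where "c < length rs" "v = f c"
      by auto
    with v have "same_product f (b, i) (c, j)"
      by (simp add: same_product_def)
    then obtain c' j' where c': "(c', j') \<in> set ws" "c' < length rs" "j' \<noteq> i" "same_product f (b, i) (c', j')"
      using candidates_complete[OF al f b \<open>c < length rs\<close> v(1)] ws by blast
    let ?z = "(r, join rs (b, i) ((c', j') # mates rs c' j'))"
    have "?z \<in> set (merges r rs (b, i) ws)"
      using set_merges[OF c'(1), of r rs "(b, i)"] unfolding fst_conv snd_conv .
    then have "?z \<in> set (children al r rs (pending 0 rs))"
      using bi by (cases r) (auto simp: Cons simp del: join.simps)
    moreover have "realised ?z"
      using represents_join[OF f b c'(2-4)] card by (auto simp: realised_def)
    ultimately show ?thesis by blast
  next
    case False
    \<comment> \<open>The new vertex shows that \<open>B\<close> is larger than the known part, so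
      the budget \<open>r\<close> is not exhausted.\<close>
    have "card (insert v (f ` {..<length rs})) \<le> card B"
      using f v finite_B by (intro card_mono) (auto simp: represents_def)
    then have "Suc (length rs) \<le> card B"
      using f False by (simp add: card_image represents_def)
    with card obtain r' where r: "r = Suc r'"
      by (cases r) auto
    let ?z = "(r', link rs b i [(length rs, j)] @ [add_entry (Row [] [] []) j [(b, i)]])"
    have "?z \<in> set (extends r' rs (b, i) (length rs) (others i))"
      using set_extends[of j "others i" r' rs "(b, i)"] v(1) by (simp add: set_others)
    then have "?z \<in> set (children al r rs (pending 0 rs))"
      using bi by (auto simp: Cons r)
    moreover have "realised ?z"
      using represents_extend[OF f b(1) v(2) False v(1,3)] card by (auto simp: realised_def r)
    ultimately show ?thesis by blast
  qed
qed

lemma refutes_sound: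
  assumes al: "only_relators al" and "refutes al n z"
  shows "\<not> realised z"
  using assms(2)
proof (induction n arbitrary: z)
  case (Suc n)
  obtain r rs where z: "z = (r, rs)"
    by (metis prod.exhaust)
  show ?case
    using Suc children_sound[OF al, of r rs] by (auto simp: z every_iff)
qed simp

lemma not_refutes:
  assumes "only_relators al" "refutes al n (r, [Row [] [] []])"
  shows "r + 1 < card B"
proof (rule ccontr)
  assume "\<not> r + 1 < card B"
  moreover obtain b where "b \<in> B"
    using B_nonempty by auto
  then have "represents (\<lambda>_. b) [Row [] [] []]"
  proof -
    have "mates [Row [] [] []] a i = []" for a i
      by (cases a; cases i) auto
    with \<open>b \<in> B\<close> show ?thesis
      by (auto simp: represents_def inj_on_def)
  qed
  ultimately have "realised (r, [Row [] [] []])"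
    by (auto simp: realised_def)
  then show False
    using refutes_sound[OF assms] by blast
qed

end

section \<open>The lower bound\<close>

lemma length_variants: "v \<in> set (variants w) \<Longrightarrow> length v = length w"
  by (auto simp: variants_def)

lemma set_orders: "(a, b, c) \<in> set orders \<longleftrightarrow> distinct [a, b, c]"
  by (cases a; cases b; cases c) (simp_all add: orders_def)

text \<open>Eight further vertices make nine in all. These have 27 half-edges, and every branching
  settles at least one, so depth 40 is ample.\<close>

lemma search_D: "refutes (variants (word_D C0 C1 C2)) 40 (8, [Row [] [] []])"
  by code_simp

lemma search_H: "refutes (variants (word_H C0 C1 C2)) 40 (8, [Row [] [] []])"
  by code_simp

lemma map_arrange:
  "map (arrange a b c) (word_D i j k) = word_D (arrange a b c i) (arrange a b c j) (arrange a b c k)"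
  "map (arrange a b c) (word_H i j k) = word_H (arrange a b c i) (arrange a b c j) (arrange a b c k)"
  "map (map (arrange a b c)) (solvable_words i j k)
    = solvable_words (arrange a b c i) (arrange a b c j) (arrange a b c k)"
  by (simp_all add: word_D_def word_H_def solvable_words_def)

context no_unique_product
begin

lemma all_solvable_words:
  assumes "distinct [a, b, c]" "w \<in> set (solvable_words a b c)"
  shows "disp s w \<noteq> 0"
proof -
  interpret r: no_unique_product "s \<circ> arrange a b c" B
    using assms(1) by (rule rearranged)
  have "set (solvable_words a b c) = map (arrange a b c) ` set (solvable_words C0 C1 C2)"
    using map_arrange(3)[of a b c C0 C1 C2] by (metis arrange.simps list.set_map)
  then obtain v where "v \<in> set (solvable_words C0 C1 C2)" "w = map (arrange a b c) v"
    using assms(2) by blast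
  then show ?thesis
    using r.solvable_words by (simp add: disp_map)
qed

lemma relator_cases:
  assumes "cyclic_word w" "length w \<le> 8" "disp s w = 0"
  obtains a b c where "distinct [a, b, c]" "disp s (word_D a b c) = 0" "w \<in> set (variants (word_D a b c))"
  | v where "v \<in> {word_H C0 C1 C2, word_H C0 C2 C1, word_H C1 C2 C0}" "disp s v = 0" "w \<in> set (variants v)"
proof -
  obtain v where v: "v \<in> set all_words" "w \<in> set (variants v)"
    using classification[OF assms(1,2)] by blast
  then have 0: "disp s v = 0"
    using disp_variants[OF v(2) even_length_all_words[OF v(1)], of s] assms(3) by simp
  from v(1) consider a b c where "distinct [a, b, c]" "v \<in> set (solvable_words a b c)"
    | a b c where "distinct [a, b, c]" "v = word_D a b c"
    | "v \<in> {word_H C0 C1 C2, word_H C0 C2 C1, word_H C1 C2 C0}"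
    unfolding all_words_def by (fastforce simp: set_orders simp del: distinct.simps)
  then show ?thesis
    using that v(2) 0 all_solvable_words by cases blast+
qed

text \<open>By \<open>word_D_unique\<close> the variants of this one word are the only short
  relators, so the first search applies.\<close>

lemma card_if_word_D:
  assumes "disp s (word_D C0 C1 C2) = 0"
  shows "10 \<le> card B"
proof -
  have "only_relators (variants (word_D C0 C1 C2))"
    unfolding only_relators_def
  proof (intro allI impI)
    fix w assume w: "cyclic_word w" "length w \<le> 8" "disp s w = 0"
    have "w \<in> set (variants (word_D C0 C1 C2))"
      using w
    proof (cases rule: relator_cases)
      case (1 a b c)
      then have "(a, b, c) \<in> set orders"
        by (simp only: set_orders)
      then show ?thesis
        using 1 word_D_unique[OF assms] by (auto simp: orders_def)
    next
      case (2 v)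
      then show ?thesis
        using word_D_unique[OF assms, of v] by auto
    qed
    then show "length w = 8 \<and> w \<in> set (variants (word_D C0 C1 C2))"
      using length_variants by (fastforce simp: word_D_def)
  qed
  from not_refutes[OF this search_D] show ?thesis by simp
qed

text \<open>This serves both when \<open>word_H C0 C1 C2\<close> is a relator and when there is no
  short relator at all: admitting more words only weakens the pruning.\<close>

lemma card_if_only_word_H:
  assumes "\<And>a b c. distinct [a, b, c] \<Longrightarrow> disp s (word_D a b c) \<noteq> 0"
    and "disp s (word_H C0 C2 C1) \<noteq> 0" "disp s (word_H C1 C2 C0) \<noteq> 0"
  shows "10 \<le> card B"
proof -
  have "only_relators (variants (word_H C0 C1 C2))"
    unfolding only_relators_def
  proof (intro allI impI)
    fix w assume w: "cyclic_word w" "length w \<le> 8" "disp s w = 0"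
    have "w \<in> set (variants (word_H C0 C1 C2))"
      using w
    proof (cases rule: relator_cases)
      case (1 a b c)
      then show ?thesis
        using assms(1) by blast
    next
      case (2 v)
      then show ?thesis
        using assms(2,3) by auto
    qed
    then show "length w = 8 \<and> w \<in> set (variants (word_H C0 C1 C2))"
      using length_variants by (fastforce simp: word_H_def)
  qed
  from not_refutes[OF this search_H] show ?thesis by simp
qed

lemma distinct_arrange:
  assumes "distinct [a, b, c]" "distinct [i, j, k]"
  shows "distinct [arrange a b c i, arrange a b c j, arrange a b c k]"
  using bij_arrange[OF assms(1)] assms(2) by (auto simp: bij_def inj_eq)

theorem card_ge_10: "10 \<le> card B"
proof -
  \<comment> \<open>In the first two cases the colours are renamed so that the relation found is in
    the arrangement \<open>C0\<close>, \<open>C1\<close>, \<open>C2\<close>.\<close>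
  consider a b c where "distinct [a, b, c]" "disp s (word_D a b c) = 0"
    | a b c where "\<And>i j k. distinct [i, j, k] \<Longrightarrow> disp s (word_D i j k) \<noteq> 0"
        "distinct [a, b, c]" "disp s (word_H a b c) = 0"
    | "\<And>i j k. distinct [i, j, k] \<Longrightarrow> disp s (word_D i j k) \<noteq> 0 \<and> disp s (word_H i j k) \<noteq> 0"
    by metis
  then show ?thesis
  proof cases
    case (1 a b c)
    interpret r: no_unique_product "s \<circ> arrange a b c" B
      using 1(1) by (rule rearranged)
    have "disp (s \<circ> arrange a b c) (word_D C0 C1 C2) = 0"
      using 1(2) by (simp add: map_arrange flip: disp_map)
    then show ?thesis
      by (rule r.card_if_word_D)
  next
    case (2 a b c)
    interpret r: no_unique_product "s \<circ> arrange a b c" B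
      using 2(2) by (rule rearranged)
    have H: "disp (s \<circ> arrange a b c) (word_H C0 C1 C2) = 0"
      using 2(3) by (simp add: map_arrange flip: disp_map)
    show ?thesis
    proof (rule r.card_if_only_word_H)
      show "disp (s \<circ> arrange a b c) (word_D i j k) \<noteq> 0" if "distinct [i, j, k]" for i j k
        using 2(1)[OF distinct_arrange[OF 2(2) that]] by (simp add: map_arrange flip: disp_map)
    qed (use r.word_H_unique[OF H] in blast)+
  next
    case 3
    have "distinct [C0, C2, C1]" "distinct [C1, C2, C0]"
      by simp_all
    with 3 show ?thesis
      by (intro card_if_only_word_H) blast+
  qed
qed

end

text \<open>The coefficient of \<alpha>\<beta> at a uniquely represented product would be a product
  of two nonzero field elements.\<close>

lemma no_unique_product_zero_divisor:
  fixes \<alpha> \<beta> :: "'g::group_add \<Rightarrow>\<^sub>0 'f::field"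
  assumes "torsion_free TYPE('g)" "\<beta> \<noteq> 0" "\<alpha> * \<beta> = 0"
    and s: "inj s" "range s = Poly_Mapping.keys \<alpha>"
  shows "no_unique_product s (Poly_Mapping.keys \<beta>)"
proof
  show "\<exists>j c. j \<noteq> i \<and> c \<in> Poly_Mapping.keys \<beta> \<and> s i + b = s j + c"
    if b: "b \<in> Poly_Mapping.keys \<beta>" for b i
  proof (rule ccontr)
    assume unique: "\<not> ?thesis"
    let ?p = "Poly_Mapping.lookup \<alpha> (s i) * Poly_Mapping.lookup \<beta> b"
    \<comment> \<open>Uniqueness collapses the convolution: \<open>l = s i\<close> leaves the term
      \<open>q = b\<close>, and any other \<open>l\<close> contributes nothing.\<close>
    have "Poly_Mapping.lookup \<alpha> l * (\<Sum>q. Poly_Mapping.lookup \<beta> q when s i + b = l + q) = (?p when l = s i)" for l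
    proof (cases "l = s i")
      case True
      have "(\<Sum>q. Poly_Mapping.lookup \<beta> q when s i + b = l + q) = (\<Sum>q. Poly_Mapping.lookup \<beta> q when q = b)"
        unfolding True by (rule Sum_any.cong) (auto simp: when_def)
      then show ?thesis
        using True by simp
    next
      case False
      show ?thesis
      proof (cases "l \<in> Poly_Mapping.keys \<alpha>")
        case True
        then obtain j where "l = s j" "j \<noteq> i"
          using s(2) False by auto
        then have "(Poly_Mapping.lookup \<beta> q when s i + b = l + q) = 0" for q
          using unique by (auto simp: when_def in_keys_iff)
        then show ?thesis
          using False by simp
      qed (use False in \<open>simp add: in_keys_iff\<close>)
    qed
    then have "Poly_Mapping.lookup (\<alpha> * \<beta>) (s i + b) = ?p"
      by (simp add: lookup_mult)
    moreover have "?p \<noteq> 0"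
      using b s(2) by (auto simp: in_keys_iff[symmetric])
    ultimately show False
      using assms(3) by simp
  qed
qed (use assms in auto)

theorem theorem1p4:
  fixes \<alpha> \<beta> :: "'g::group_add \<Rightarrow>\<^sub>0 'f::field"
  assumes "torsion_free TYPE('g)"
    and "\<alpha> \<noteq> 0" and "\<beta> \<noteq> 0"
    and "card (Poly_Mapping.keys \<alpha>) = 3"
    and "\<alpha> * \<beta> = 0"
  shows "card (Poly_Mapping.keys \<beta>) \<ge> 10"
proof -
  obtain a b c where abc: "Poly_Mapping.keys \<alpha> = {a, b, c}" "a \<noteq> b" "b \<noteq> c" "a \<noteq> c"
    using assms(4) by (auto simp: card_3_iff)
  have "inj (case_colour a b c)"
    using abc by (auto simp: inj_def split: colour.splits)
  moreover have "range (case_colour a b c) = Poly_Mapping.keys \<alpha>"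
    by (auto simp: abc UNIV_colour)
  ultimately interpret no_unique_product "case_colour a b c" "Poly_Mapping.keys \<beta>"
    using assms by (intro no_unique_product_zero_divisor)
  show ?thesis
    by (rule card_ge_10)
qed

end
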